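(* Let $G$ be a finite abelian group with unit element $e$, let $H$ be a subgroup of $G$, and let $\widehat{H}$ be the dual group of $H$. Then for every $h \in H$ there exists a homogeneous polynomial $A_{h} \in \mathbb{C}[x_{g}]$ with $\deg A_{h} = [G : H]$ such that the following equality holds in the group algebra $\mathbb{C}[x_{g}]H$: $$ \Theta(G)\, e = \prod_{\chi \in \widehat{H}} \sum_{h \in H} \chi(h) A_{h} h . $$ Moreover, if $H = G$, we can take $A_{h} = x_{h}$ for each $h \in H$.
   Context: For a finite group $G$, $\{x_{g} \mid g \in G\}$ is a family of independent commuting variables indexed by $G$, and $\mathbb{C}[x_{g}] = \mathbb{C}[x_{g}; g \in G]$ is the polynomial ring in these variables over $\mathbb{C}$. The group determinant of $G$ is $\Theta(G) = \det\left(x_{gh^{-1}}\right)_{g,h \in G} \in \mathbb{C}[x_{g}]$, the determinant of the matrix with rows and columns indexed by the elements of $G$ (in the same, arbitrary, ordering). $\mathbb{C}[x_{g}]G = \mathbb{C}[x_g]\otimes\mathbb{C}G = \{\sum_{g \in G} A_{g} g \mid A_{g} \in \mathbb{C}[x_{g}]\}$ is the group algebra of $G$ over $\mathbb{C}[x_{g}]$. For a subgroup $H$ of $G$, $\mathbb{C}[x_{g}]H = \{\sum_{h \in H} A_{h} h \mid A_{h} \in \mathbb{C}[x_{g}]\}$ (coefficients are polynomials in all the variables $x_g$, $g \in G$). $[G:H]$ is the index of $H$ in $G$. For a finite abelian group $H$, the dual group $\widehat{H}$ is the group of characters of $H$, i.e. of group homomorphisms $H \to \mathbb{C}^{\times}$.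 *)

theory Defs
  imports
    "HOL-Library.Poly_Mapping"
    "HOL-Algebra.Coset"
    "HOL-Algebra.Algebraic_Closure_Type"
    "Jordan_Normal_Form.Determinant"
begin

(* A monomial is a finitely supported exponent vector; a polynomial is a finitely supported
   family of coefficients indexed by monomials. The product of the Poly_Mapping type class
   instance is the convolution product, i.e. the multiplication of polynomials. *)
type_synonym 'a cpoly = "('a \<Rightarrow>\<^sub>0 nat) \<Rightarrow>\<^sub>0 complex"

definition pvar :: "'a \<Rightarrow> 'a cpoly" where
  "pvar g = Poly_Mapping.single (Poly_Mapping.single g 1) 1"

definition pconst :: "complex \<Rightarrow> 'a cpoly" where
  "pconst c = Poly_Mapping.single 0 c"

definition cpoly_ring :: "'a set \<Rightarrow> 'a cpoly ring" where
  "cpoly_ring V =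
     ring_of_type_algebra\<lparr>carrier := {p. \<forall>m \<in> Poly_Mapping.keys p. Poly_Mapping.keys m \<subseteq> V}\<rparr>"

definition monomial_degree :: "('a \<Rightarrow>\<^sub>0 nat) \<Rightarrow> nat" where
  "monomial_degree m = (\<Sum>g \<in> Poly_Mapping.keys m. Poly_Mapping.lookup m g)"

(* The zero polynomial is homogeneous and gets total degree 0, so a homogeneous polynomial
   whose total degree is positive is nonzero. *)
definition total_degree :: "'a cpoly \<Rightarrow> nat" where
  "total_degree p = Max (insert 0 (monomial_degree ` Poly_Mapping.keys p))"

definition homogeneous :: "'a cpoly \<Rightarrow> bool" where
  "homogeneous p \<longleftrightarrow> (\<exists>d. \<forall>m \<in> Poly_Mapping.keys p. monomial_degree m = d)"

(* The enumeration f fixes an arbitrary common ordering of the rows and the columns. *)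
definition group_determinant :: "('a, 'b) monoid_scheme \<Rightarrow> 'a cpoly" where
  "group_determinant G =
     (let f = (SOME f. bij_betw f {0..<card (carrier G)} (carrier G))
      in det (mat (card (carrier G)) (card (carrier G))
               (\<lambda>(i, j). pvar (f i \<otimes>\<^bsub>G\<^esub> inv\<^bsub>G\<^esub> (f j)))))"

(* Group algebra of a finite group S over R. The function f stands for the formal sum of the
   f x x over x in S; functions are extensional so that equal elements are equal functions. *)
definition group_algebra :: "('r, 'm) ring_scheme \<Rightarrow> ('a, 'b) monoid_scheme \<Rightarrow> ('a \<Rightarrow> 'r) ring" where
  "group_algebra R S =
     \<lparr>carrier = carrier S \<rightarrow>\<^sub>E carrier R,
      monoid.mult = (\<lambda>f g. \<lambda>x \<in> carrier S. \<Oplus>\<^bsub>R\<^esub> y \<in> carrier S. f y \<otimes>\<^bsub>R\<^esub> g (inv\<^bsub>S\<^esub> y \<otimes>\<^bsub>S\<^esub> x)),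
      monoid.one = (\<lambda>x \<in> carrier S. if x = \<one>\<^bsub>S\<^esub> then \<one>\<^bsub>R\<^esub> else \<zero>\<^bsub>R\<^esub>),
      ring.zero = (\<lambda>x \<in> carrier S. \<zero>\<^bsub>R\<^esub>),
      ring.add = (\<lambda>f g. \<lambda>x \<in> carrier S. f x \<oplus>\<^bsub>R\<^esub> g x)\<rparr>"

(* The element a s of the group algebra, for a in R and s in S. *)
definition group_algebra_term ::
  "('r, 'm) ring_scheme \<Rightarrow> ('a, 'b) monoid_scheme \<Rightarrow> 'r \<Rightarrow> 'a \<Rightarrow> ('a \<Rightarrow> 'r)" where
  "group_algebra_term R S a s = (\<lambda>x \<in> carrier S. if x = s then a else \<zero>\<^bsub>R\<^esub>)"

(* hom alone does not determine a function outside the carrier; extensionality makes every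
   character of S a single element. *)
definition dual_group :: "('a, 'b) monoid_scheme \<Rightarrow> ('a \<Rightarrow> complex) monoid" where
  "dual_group S =
     \<lparr>carrier = hom S (units_of (ring_of_type_algebra :: complex ring)) \<inter> extensional (carrier S),
      monoid.mult = (\<lambda>\<chi> \<psi>. \<lambda>x \<in> carrier S. \<chi> x * \<psi> x),
      monoid.one = (\<lambda>x \<in> carrier S. 1)\<rparr>"

end

theory Submission
  imports Defs
begin

text \<open>
  Write \<open>e\<close> for the unit element and \<open>x\<^sub>g\<close> for the variables. For a character \<open>\<chi>\<close> of a finite abelian
  group, the linear extension of \<open>\<chi>\<close> to the group algebra, here called the Fourier transform at \<open>\<chi>\<close>, is
  a ring homomorphism into the coefficient ring; by the orthogonality relations, the transforms at
  all characters together are injective, and every family of values is attained. An identity in the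
  group algebra of \<open>H\<close> is therefore the same as a family of identities between polynomials, indexed by
  the characters \<open>\<phi>\<close> of \<open>H\<close>.

  On the left-hand side the transform of \<open>\<Theta>(G) e\<close> is \<open>\<Theta>(G)\<close> at every \<open>\<phi>\<close>. On the right-hand side, the
  factor for \<open>\<chi>\<close> has as its transform at \<open>\<phi>\<close> the transform of \<open>A = \<Sum>h. A\<^sub>h * h\<close> at \<open>\<phi> \<chi>\<close>, and
  multiplication by \<open>\<phi>\<close> permutes the characters. So the equality holds for a family \<open>A\<close> if and only if
  \<open>\<Theta>(G)\<close> is the product of all transforms of \<open>A\<close> (\<open>group_algebra_factorization\<close>).

  Such a family is read off from Dedekind's factorization of \<open>\<Theta>(G)\<close> into the linear forms
  \<open>L\<^sub>\<psi> = \<Sum>g. \<psi> g * x\<^sub>g\<close>, one for each character \<open>\<psi>\<close> of \<open>G\<close> (\<open>group_determinant_eq_prod\<close>): collect the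
  forms \<open>L\<^sub>\<psi>\<close> according to the restriction of \<open>\<psi>\<close> to \<open>H\<close>, and let \<open>A\<close> be the family whose transform at
  \<open>\<chi>\<close> is the product of the \<open>L\<^sub>\<psi>\<close> with \<open>\<psi>\<close> extending \<open>\<chi>\<close>. By Fourier inversion \<open>A\<^sub>h\<close> is a linear combination
  of these products. Each \<open>\<chi>\<close> has exactly \<open>[G : H]\<close> extensions (\<open>card_extensions_of_character\<close>), so \<open>A\<^sub>h\<close>
  is homogeneous of that degree unless it vanishes, and a suitable substitution shows that it does
  not (\<open>subgroup_coefficient_nonzero\<close>). For \<open>H = G\<close> the transforms of \<open>A\<close> are the \<open>L\<^sub>\<psi>\<close> themselves, so that
  \<open>A\<^sub>h = x\<^sub>h\<close>.

  Both Dedekind's factorization and Fourier inversion rest on the existence of enough characters,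
  that is, on the extension of characters from a subgroup (\<open>character_extension\<close>).
\<close>

section \<open>Polynomials and their evaluation\<close>

lemma pconst_0 [simp]: "pconst 0 = 0"
  by (simp add: pconst_def)

lemma pconst_1 [simp]: "pconst 1 = 1"
  by (simp add: pconst_def)

lemma pconst_mult: "pconst (a * b) = pconst a * pconst b"
  by (simp add: pconst_def mult_single)

lemma pconst_sum: "pconst (sum f I) = (\<Sum>i\<in>I. pconst (f i))"
  by (induction I rule: infinite_finite_induct) (simp_all add: pconst_def single_add)

text \<open>
  Fixing the degree, zero polynomial included, makes these sets closed under addition, which the
  homogeneous polynomials are not.
\<close>

definition forms :: "'a set \<Rightarrow> nat \<Rightarrow> 'a cpoly set" where
  "forms V d = {p. \<forall>m \<in> Poly_Mapping.keys p. Poly_Mapping.keys m \<subseteq> V \<and> monomial_degree m = d}"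

text \<open>
  With a common finite range of summation, degrees of different monomials can be added termwise;
  the analogous lemmas below serve the same purpose.
\<close>

lemma monomial_degree_superset:
  assumes "finite F" "Poly_Mapping.keys m \<subseteq> F"
  shows "monomial_degree m = (\<Sum>g\<in>F. Poly_Mapping.lookup m g)"
  unfolding monomial_degree_def using assms
  by (intro sum.mono_neutral_left) (auto simp: in_keys_iff)

lemma monomial_degree_add: "monomial_degree (m + n) = monomial_degree m + monomial_degree n"
proof -
  let ?F = "Poly_Mapping.keys m \<union> Poly_Mapping.keys n"
  have "monomial_degree k = (\<Sum>g\<in>?F. Poly_Mapping.lookup k g)" if "k \<in> {m, n, m + n}" for k
    using that Poly_Mapping.keys_add[of m n] by (intro monomial_degree_superset) auto
  then show ?thesis
    by (simp add: lookup_add sum.distrib)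
qed

lemma forms_add:
  assumes "p \<in> forms V d" "q \<in> forms V d" shows "p + q \<in> forms V d"
  using assms Poly_Mapping.keys_add[of p q] by (fastforce simp: forms_def)

lemma zero_in_forms: "0 \<in> forms V d"
  by (simp add: forms_def)

lemma forms_sum: "(\<And>i. i \<in> I \<Longrightarrow> f i \<in> forms V d) \<Longrightarrow> sum f I \<in> forms V d"
  by (induction I rule: infinite_finite_induct) (auto simp: forms_add zero_in_forms)

lemma forms_mult:
  assumes "p \<in> forms V c" "q \<in> forms V d" shows "p * q \<in> forms V (c + d)"
  unfolding forms_def
proof (intro CollectI ballI)
  fix m assume "m \<in> Poly_Mapping.keys (p * q)"
  then obtain a b where "m = a + b" "a \<in> Poly_Mapping.keys p" "b \<in> Poly_Mapping.keys q"
    using keys_mult by blast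
  with assms show "Poly_Mapping.keys m \<subseteq> V \<and> monomial_degree m = c + d"
    using Poly_Mapping.keys_add[of a b] by (fastforce simp: forms_def monomial_degree_add)
qed

lemma pconst_in_forms: "pconst c \<in> forms V 0"
  by (auto simp: forms_def pconst_def monomial_degree_def)

lemma pvar_in_forms: "g \<in> V \<Longrightarrow> pvar g \<in> forms V 1"
  by (auto simp: forms_def pvar_def monomial_degree_def)

lemma forms_pconst_mult: "p \<in> forms V d \<Longrightarrow> pconst c * p \<in> forms V d"
  using forms_mult[OF pconst_in_forms] by fastforce

lemma forms_prod: "(\<And>i. i \<in> I \<Longrightarrow> f i \<in> forms V 1) \<Longrightarrow> finite I \<Longrightarrow> prod f I \<in> forms V (card I)"
proof (induction I rule: infinite_finite_induct)
  case empty
  then show ?case using pconst_in_forms[of 1 V] by simp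
next
  case (insert i I)
  then have "f i * prod f I \<in> forms V (1 + card I)"
    by (intro forms_mult) auto
  with insert show ?case by simp
qed simp

lemma forms_carrier: "p \<in> forms V d \<Longrightarrow> p \<in> carrier (cpoly_ring V)"
  by (auto simp: forms_def cpoly_ring_def)

lemma forms_homogeneous: "p \<in> forms V d \<Longrightarrow> homogeneous p"
  by (auto simp: forms_def homogeneous_def)

lemma forms_total_degree:
  assumes "p \<in> forms V d" "p \<noteq> 0" shows "total_degree p = d"
proof -
  have "Poly_Mapping.keys p \<noteq> {}"
    using assms(2) by simp
  then have "monomial_degree ` Poly_Mapping.keys p = {d}"
    using assms(1) by (auto simp: forms_def image_iff simp del: keys_eq_empty)
  then show ?thesis by (simp add: total_degree_def)
qed

definition monomial_value :: "('a \<Rightarrow> complex) \<Rightarrow> ('a \<Rightarrow>\<^sub>0 nat) \<Rightarrow> complex" where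
  "monomial_value v m = (\<Prod>g\<in>Poly_Mapping.keys m. v g ^ Poly_Mapping.lookup m g)"

text \<open>
  Substitution of complex numbers for the variables, used to recognize a polynomial as nonzero.
\<close>

definition cpoly_value :: "('a \<Rightarrow> complex) \<Rightarrow> 'a cpoly \<Rightarrow> complex" where
  "cpoly_value v p = (\<Sum>m\<in>Poly_Mapping.keys p. Poly_Mapping.lookup p m * monomial_value v m)"

lemma monomial_value_superset:
  assumes "finite F" "Poly_Mapping.keys m \<subseteq> F"
  shows "monomial_value v m = (\<Prod>g\<in>F. v g ^ Poly_Mapping.lookup m g)"
  unfolding monomial_value_def using assms
  by (intro prod.mono_neutral_left) (auto simp: in_keys_iff)

lemma monomial_value_add: "monomial_value v (m + n) = monomial_value v m * monomial_value v n"
proof -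
  let ?F = "Poly_Mapping.keys m \<union> Poly_Mapping.keys n"
  have "monomial_value v k = (\<Prod>g\<in>?F. v g ^ Poly_Mapping.lookup k g)" if "k \<in> {m, n, m + n}" for k
    using that Poly_Mapping.keys_add[of m n] by (intro monomial_value_superset) auto
  then show ?thesis
    by (simp add: lookup_add power_add prod.distrib)
qed

lemma cpoly_value_superset:
  assumes "finite F" "Poly_Mapping.keys p \<subseteq> F"
  shows "cpoly_value v p = (\<Sum>m\<in>F. Poly_Mapping.lookup p m * monomial_value v m)"
  unfolding cpoly_value_def using assms
  by (intro sum.mono_neutral_left) (auto simp: in_keys_iff)

lemma cpoly_value_add: "cpoly_value v (p + q) = cpoly_value v p + cpoly_value v q"
proof -
  let ?F = "Poly_Mapping.keys p \<union> Poly_Mapping.keys q"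
  have "cpoly_value v k = (\<Sum>m\<in>?F. Poly_Mapping.lookup k m * monomial_value v m)" if "k \<in> {p, q, p + q}" for k
    using that Poly_Mapping.keys_add[of p q] by (intro cpoly_value_superset) auto
  then show ?thesis
    by (simp add: lookup_add sum.distrib distrib_right)
qed

lemma cpoly_value_0 [simp]: "cpoly_value v 0 = 0"
  by (simp add: cpoly_value_def)

lemma cpoly_value_sum: "cpoly_value v (sum f I) = (\<Sum>i\<in>I. cpoly_value v (f i))"
  by (induction I rule: infinite_finite_induct) (simp_all add: cpoly_value_add)

lemma cpoly_value_single: "cpoly_value v (Poly_Mapping.single m c) = c * monomial_value v m"
  by (cases "c = 0") (simp_all add: cpoly_value_def)

lemma cpoly_sum_of_terms:
  "(p :: 'a cpoly) = (\<Sum>m\<in>Poly_Mapping.keys p. Poly_Mapping.single m (Poly_Mapping.lookup p m))"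
  by (rule poly_mapping_eqI)
    (auto simp: lookup_sum lookup_single when_def in_keys_iff)

lemma cpoly_value_mult: "cpoly_value v (p * q) = cpoly_value v p * cpoly_value v q"
proof -
  let ?t = "\<lambda>p m. Poly_Mapping.single m (Poly_Mapping.lookup p m)"
  have "cpoly_value v (p * q) =
      cpoly_value v (\<Sum>m\<in>Poly_Mapping.keys p. \<Sum>n\<in>Poly_Mapping.keys q. ?t p m * ?t q n)"
    by (subst cpoly_sum_of_terms[of p], subst cpoly_sum_of_terms[of q]) (simp add: sum_product)
  also have "\<dots> = cpoly_value v p * cpoly_value v q"
    unfolding cpoly_value_def[of v p] cpoly_value_def[of v q]
    by (simp add: cpoly_value_sum mult_single cpoly_value_single monomial_value_add sum_product
        mult_ac)
  finally show ?thesis .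
qed

lemma cpoly_value_pconst [simp]: "cpoly_value v (pconst c) = c"
  by (simp add: pconst_def cpoly_value_single monomial_value_def)

lemma cpoly_value_pvar [simp]: "cpoly_value v (pvar g) = v g"
  by (simp add: pvar_def cpoly_value_single monomial_value_def)

lemma cpoly_value_prod: "cpoly_value v (prod f I) = (\<Prod>i\<in>I. cpoly_value v (f i))"
  using cpoly_value_pconst[of v 1]
  by (induction I rule: infinite_finite_induct) (simp_all add: cpoly_value_mult)

section \<open>The ring of polynomials in a given set of variables\<close>

lemma cpoly_ring_simps [simp]:
  "monoid.mult (cpoly_ring V) = (*)" "one (cpoly_ring V) = 1"
  "ring.zero (cpoly_ring V) = 0" "add (cpoly_ring V) = (+)"
  by (simp_all add: cpoly_ring_def ring_of_type_algebra_def)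

lemma cpoly_ring_carrier:
  "p \<in> carrier (cpoly_ring V) \<longleftrightarrow> (\<forall>m \<in> Poly_Mapping.keys p. Poly_Mapping.keys m \<subseteq> V)"
  by (simp add: cpoly_ring_def)

lemma cpoly_carrier_add:
  assumes "p \<in> carrier (cpoly_ring V)" "q \<in> carrier (cpoly_ring V)" 
  shows "p + q \<in> carrier (cpoly_ring V)"
  using assms Poly_Mapping.keys_add[of p q] by (fastforce simp: cpoly_ring_carrier)

lemma cpoly_carrier_mult:
  assumes "p \<in> carrier (cpoly_ring V)" "q \<in> carrier (cpoly_ring V)" 
  shows "p * q \<in> carrier (cpoly_ring V)"
  unfolding cpoly_ring_carrier
proof
  fix m assume "m \<in> Poly_Mapping.keys (p * q)"
  then obtain a b where "m = a + b" "a \<in> Poly_Mapping.keys p" "b \<in> Poly_Mapping.keys q"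
    using keys_mult by blast
  with assms show "Poly_Mapping.keys m \<subseteq> V"
    using Poly_Mapping.keys_add[of a b] by (force simp: cpoly_ring_carrier)
qed

lemma pconst_carrier: "pconst c \<in> carrier (cpoly_ring V)"
  by (rule forms_carrier[OF pconst_in_forms])

lemma cpoly_carrier_0: "0 \<in> carrier (cpoly_ring V)"
  and cpoly_carrier_1: "1 \<in> carrier (cpoly_ring V)"
  using pconst_carrier[of 0 V] pconst_carrier[of 1 V] by simp_all

lemma cpoly_carrier_uminus: 
  "p \<in> carrier (cpoly_ring V) \<Longrightarrow> - p \<in> carrier (cpoly_ring V)"
  by (simp add: cpoly_ring_carrier)

lemma cring_cpoly_ring: "cring (cpoly_ring V)"
proof (rule cringI)
  show "abelian_group (cpoly_ring V)"
  proof (rule abelian_groupI)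
    show "\<exists>y\<in>carrier (cpoly_ring V). y \<oplus>\<^bsub>cpoly_ring V\<^esub> x = \<zero>\<^bsub>cpoly_ring V\<^esub>"
      if "x \<in> carrier (cpoly_ring V)" for x
      using that by (intro bexI[of _ "- x"]) (simp_all add: cpoly_carrier_uminus)
  qed (simp_all add: cpoly_carrier_add cpoly_carrier_0 ac_simps)
  show "Group.comm_monoid (cpoly_ring V)"
    by (rule comm_monoidI) (simp_all add: cpoly_carrier_mult cpoly_carrier_1 ac_simps)
qed (simp add: distrib_right)

lemma finsum_cpoly_ring:
  assumes "f \<in> I \<rightarrow> carrier (cpoly_ring V)" 
  shows "finsum (cpoly_ring V) f I = sum f I"
proof -
  interpret cring "cpoly_ring V" by (rule cring_cpoly_ring)
  show ?thesis using assms
    by (induction I rule: infinite_finite_induct) (simp_all add: finsum_infinite Pi_def)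
qed

lemma finprod_cpoly_ring:
  assumes "f \<in> I \<rightarrow> carrier (cpoly_ring V)" 
  shows "finprod (cpoly_ring V) f I = prod f I"
proof -
  interpret cring "cpoly_ring V" by (rule cring_cpoly_ring)
  show ?thesis using assms
    by (induction I rule: infinite_finite_induct) (simp_all add: finprod_infinite Pi_def)
qed

lemma sum_cpoly_carrier:
  "(\<And>i. i \<in> I \<Longrightarrow> f i \<in> carrier (cpoly_ring V)) \<Longrightarrow> sum f I \<in> carrier (cpoly_ring V)"
  by (induction I rule: infinite_finite_induct) (simp_all add: cpoly_carrier_add cpoly_carrier_0)

section \<open>Characters of finite abelian groups\<close>

lemma comm_group_subgroup:
  assumes "Group.comm_group G" "subgroup H G" shows "Group.comm_group (G\<lparr>carrier := H\<rparr>)"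
proof -
  interpret Group.comm_group G by fact
  interpret subgroup H G by fact
  show ?thesis
    by (rule group.group_comm_groupI[OF subgroup_is_group[OF group_axioms]]) (simp add: m_comm)
qed

lemma dual_group_iff:
  "\<chi> \<in> carrier (dual_group S) \<longleftrightarrow> \<chi> \<in> extensional (carrier S) \<and> (\<forall>x\<in>carrier S. \<chi> x \<noteq> 0) \<and>
    (\<forall>x\<in>carrier S. \<forall>y\<in>carrier S. \<chi> (x \<otimes>\<^bsub>S\<^esub> y) = \<chi> x * \<chi> y)"
proof -
  have "Units (ring_of_type_algebra :: complex ring) = {z. z \<noteq> 0}"
    by (auto simp: Units_def ring_of_type_algebra_def) (metis left_inverse right_inverse)
  then show ?thesis
    by (auto simp: dual_group_def hom_def units_of_def ring_of_type_algebra_def)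
qed

lemma character_mult:
  "\<lbrakk>\<chi> \<in> carrier (dual_group S); x \<in> carrier S; y \<in> carrier S\<rbrakk> \<Longrightarrow> \<chi> (x \<otimes>\<^bsub>S\<^esub> y) = \<chi> x * \<chi> y"
  by (simp add: dual_group_iff)

lemma character_nonzero: "\<lbrakk>\<chi> \<in> carrier (dual_group S); x \<in> carrier S\<rbrakk> \<Longrightarrow> \<chi> x \<noteq> 0"
  by (simp add: dual_group_iff)

lemma character_one:
  assumes "Group.group S" "\<chi> \<in> carrier (dual_group S)" shows "\<chi> \<one>\<^bsub>S\<^esub> = 1"
proof -
  interpret Group.group S by fact
  show ?thesis
    using character_mult[OF assms(2), of "\<one>\<^bsub>S\<^esub>" "\<one>\<^bsub>S\<^esub>"] character_nonzero[OF assms(2), of "\<one>\<^bsub>S\<^esub>"] by simp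
qed

lemma character_pow:
  assumes "Group.group S" "\<chi> \<in> carrier (dual_group S)" "x \<in> carrier S"
  shows "\<chi> (x [^]\<^bsub>S\<^esub> (n::nat)) = \<chi> x ^ n"
proof -
  interpret Group.group S by fact
  show ?thesis
    using assms by (induction n) (simp_all add: character_one character_mult)
qed

lemma character_inv:
  assumes "Group.group S" "\<chi> \<in> carrier (dual_group S)" "x \<in> carrier S"
  shows "\<chi> (inv\<^bsub>S\<^esub> x) = inverse (\<chi> x)"
proof -
  interpret Group.group S by fact
  have "\<chi> (inv\<^bsub>S\<^esub> x) * \<chi> x = 1"
    using character_mult[OF assms(2), of "inv\<^bsub>S\<^esub> x" x] character_one[OF assms(1,2)] assms(3) by simp
  then show ?thesis by (metis inverse_unique mult.commute)
qed

lemma dual_group_simps [simp]: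
  "\<chi> \<otimes>\<^bsub>dual_group S\<^esub> \<psi> = (\<lambda>x\<in>carrier S. \<chi> x * \<psi> x)" "\<one>\<^bsub>dual_group S\<^esub> = (\<lambda>x\<in>carrier S. 1)"
  by (simp_all add: dual_group_def)

lemma inverse_character:
  assumes "Group.group S" "\<chi> \<in> carrier (dual_group S)"
  shows "(\<lambda>x\<in>carrier S. inverse (\<chi> x)) \<in> carrier (dual_group S)"
proof -
  interpret Group.group S by fact
  show ?thesis using assms(2) by (simp add: dual_group_iff)
qed

lemma comm_group_dual_group:
  assumes "Group.group S" shows "Group.comm_group (dual_group S)"
proof -
  interpret Group.group S by fact
  show ?thesis
  proof (rule comm_groupI)
    show "\<exists>\<psi>\<in>carrier (dual_group S). \<psi> \<otimes>\<^bsub>dual_group S\<^esub> \<chi> = \<one>\<^bsub>dual_group S\<^esub>"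
      if "\<chi> \<in> carrier (dual_group S)" for \<chi>
      using inverse_character[OF assms that] that
      by (intro bexI[of _ "\<lambda>x\<in>carrier S. inverse (\<chi> x)"])
        (auto simp: dual_group_iff intro!: restrict_ext)
  qed (auto simp: dual_group_iff mult_ac fun_eq_iff restrict_def extensional_def)
qed

lemma finite_dual_group:
  assumes "Group.group S" "finite (carrier S)" shows "finite (carrier (dual_group S))"
proof -
  interpret Group.group S by fact
  have "0 < Coset.order S" using assms(2) order_gt_0_iff_finite by blast
  then have "finite {z::complex. z ^ Coset.order S = 1}"
    by (intro finite_roots_unity) simp
  then have "finite (carrier S \<rightarrow>\<^sub>E {z::complex. z ^ Coset.order S = 1})"
    using assms(2) by (intro finite_PiE)
  moreover have "carrier (dual_group S) \<subseteq> carrier S \<rightarrow>\<^sub>E {z::complex. z ^ Coset.order S = 1}"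
  proof
    fix \<chi> assume \<chi>: "\<chi> \<in> carrier (dual_group S)"
    have "\<chi> x ^ Coset.order S = 1" if "x \<in> carrier S" for x
      using character_pow[OF assms(1) \<chi> that, of "Coset.order S"] that
      by (simp add: pow_order_eq_1 character_one[OF assms(1) \<chi>])
    then show "\<chi> \<in> carrier S \<rightarrow>\<^sub>E {z::complex. z ^ Coset.order S = 1}"
      using \<chi> by (simp add: dual_group_iff PiE_iff)
  qed
  ultimately show ?thesis by (rule rev_finite_subset)
qed

text \<open>
  The elements of the subgroup generated by \<open>K\<close> and \<open>a\<close> are the products \<open>k a\<^sup>i\<close>, and the extension must
  send such a product to \<open>\<chi> k * c\<^sup>i\<close>. The only relations between these products come from powers of
  \<open>a\<close> that lie in \<open>K\<close>, all of which are powers of \<open>a\<^sup>m\<close>; so the condition on \<open>c\<close> is enough. Leaving the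
  choice of \<open>c\<close> open lets the same construction extend characters and separate points.
\<close>

lemma extend_character_by_element:
  fixes G :: "('a, 'b) monoid_scheme"
  assumes "Group.comm_group G" "finite (carrier G)" "subgroup K G" and a: "a \<in> carrier G"
    and \<chi>: "\<chi> \<in> carrier (dual_group (G\<lparr>carrier := K\<rparr>))"
    and m: "0 < m" "a [^]\<^bsub>G\<^esub> m \<in> K" "\<And>i. \<lbrakk>0 < i; a [^]\<^bsub>G\<^esub> i \<in> K\<rbrakk> \<Longrightarrow> m \<le> (i::nat)"
    and c: "c ^ m = \<chi> (a [^]\<^bsub>G\<^esub> m)"
  obtains K' \<chi>' where "subgroup K' G" "insert a K \<subseteq> K'"
    "\<chi>' \<in> carrier (dual_group (G\<lparr>carrier := K'\<rparr>))" "\<And>x. x \<in> K \<Longrightarrow> \<chi>' x = \<chi> x" "\<chi>' a = c"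
proof -
  interpret G: Group.comm_group G by fact
  interpret K: subgroup K G by fact
  let ?S = "G\<lparr>carrier := K\<rparr>"
  have S: "Group.group ?S" by (rule K.subgroup_is_group[OF G.group_axioms])
  have mul: "\<chi> (x \<otimes>\<^bsub>G\<^esub> y) = \<chi> x * \<chi> y" if "x \<in> K" "y \<in> K" for x y
    using character_mult[OF \<chi>, of x y] that by simp
  have nz: "\<chi> x \<noteq> 0" if "x \<in> K" for x
    using character_nonzero[OF \<chi>, of x] that by simp
  have one: "\<chi> \<one>\<^bsub>G\<^esub> = 1"
    using character_one[OF S \<chi>] by simp
  have pow_closed: "x [^]\<^bsub>G\<^esub> (n::nat) \<in> K" if "x \<in> K" for x n
    using that by (induction n) simp_all
  have pow: "\<chi> (x [^]\<^bsub>G\<^esub> (n::nat)) = \<chi> x ^ n" if "x \<in> K" for x n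
    using that by (induction n) (simp_all add: one mul pow_closed)
  have "c \<noteq> 0" using c nz[OF m(2)] m(1) by (metis power_0_left less_irrefl)
  \<comment> \<open>Minimality of \<open>m\<close> makes every exponent whose power lies in \<open>K\<close> a multiple of \<open>m\<close>.\<close>
  have value_pow: "a [^]\<^bsub>G\<^esub> i \<in> K \<Longrightarrow> \<chi> (a [^]\<^bsub>G\<^esub> i) = c ^ i" for i :: nat
  proof -
    assume i: "a [^]\<^bsub>G\<^esub> i \<in> K"
    define q where "q = (a [^]\<^bsub>G\<^esub> m) [^]\<^bsub>G\<^esub> (i div m)"
    have q: "q \<in> K" unfolding q_def by (rule pow_closed[OF m(2)])
    have "a [^]\<^bsub>G\<^esub> i = q \<otimes>\<^bsub>G\<^esub> a [^]\<^bsub>G\<^esub> (i mod m)"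
      using a unfolding q_def by (simp add: G.nat_pow_pow G.nat_pow_mult)
    then have "a [^]\<^bsub>G\<^esub> (i mod m) = inv\<^bsub>G\<^esub> q \<otimes>\<^bsub>G\<^esub> a [^]\<^bsub>G\<^esub> i"
      using a q by (simp add: G.inv_solve_left)
    with q i have "a [^]\<^bsub>G\<^esub> (i mod m) \<in> K" by simp
    then have "i mod m = 0"
      using m(1) m(3)[of "i mod m"] by (metis mod_less_divisor not_gr_zero not_le)
    then have i_eq: "i = m * (i div m)" by auto
    have "\<chi> (a [^]\<^bsub>G\<^esub> i) = \<chi> q"
      unfolding q_def using a i_eq by (simp add: G.nat_pow_pow)
    also have "\<dots> = c ^ (m * (i div m))"
      using pow[OF m(2)] by (simp add: q_def c power_mult)
    finally show ?thesis using i_eq by simp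
  qed
  have well_defined_le: "\<chi> k * c ^ i = \<chi> l * c ^ j"
    if "k \<in> K" "l \<in> K" "k \<otimes>\<^bsub>G\<^esub> a [^]\<^bsub>G\<^esub> i = l \<otimes>\<^bsub>G\<^esub> a [^]\<^bsub>G\<^esub> j" "i \<le> j" for k l and i j :: nat
  proof -
    have "k \<otimes>\<^bsub>G\<^esub> a [^]\<^bsub>G\<^esub> i = (l \<otimes>\<^bsub>G\<^esub> a [^]\<^bsub>G\<^esub> (j - i)) \<otimes>\<^bsub>G\<^esub> a [^]\<^bsub>G\<^esub> i"
      using that a by (simp add: G.m_assoc G.nat_pow_mult)
    then have k: "k = l \<otimes>\<^bsub>G\<^esub> a [^]\<^bsub>G\<^esub> (j - i)"
      using that a by simp
    then have "a [^]\<^bsub>G\<^esub> (j - i) = inv\<^bsub>G\<^esub> l \<otimes>\<^bsub>G\<^esub> k"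
      using that a by (simp add: G.inv_solve_left)
    then have K: "a [^]\<^bsub>G\<^esub> (j - i) \<in> K" using that by simp
    then have "\<chi> k = \<chi> l * c ^ (j - i)"
      using mul[OF that(2) K] value_pow[OF K] by (simp add: k[symmetric])
    then show ?thesis using that(4) by (simp add: power_add[symmetric])
  qed
  then have well_defined: "\<chi> k * c ^ i = \<chi> l * c ^ j"
    if "k \<in> K" "l \<in> K" "k \<otimes>\<^bsub>G\<^esub> a [^]\<^bsub>G\<^esub> i = l \<otimes>\<^bsub>G\<^esub> a [^]\<^bsub>G\<^esub> j" for k l and i j :: nat
    using that by (metis nat_le_linear)
  \<comment> \<open>Finiteness makes natural exponents sufficient.\<close>
  define K' where "K' = K <#>\<^bsub>G\<^esub> generate G {a}"
  have K': "x \<in> K' \<longleftrightarrow> (\<exists>k\<in>K. \<exists>i::nat. x = k \<otimes>\<^bsub>G\<^esub> a [^]\<^bsub>G\<^esub> i)" for x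
    unfolding K'_def set_mult_def G.generate_pow_on_finite_carrier[OF assms(2) a] by auto
  have sub: "subgroup K' G"
    unfolding K'_def using a by (intro G.mult_subgroups assms(3) G.generate_is_subgroup) auto
  define \<chi>' where "\<chi>' = (\<lambda>x\<in>K'. THE z. \<exists>k\<in>K. \<exists>i::nat. x = k \<otimes>\<^bsub>G\<^esub> a [^]\<^bsub>G\<^esub> i \<and> z = \<chi> k * c ^ i)"
  have \<chi>': "\<chi>' (k \<otimes>\<^bsub>G\<^esub> a [^]\<^bsub>G\<^esub> i) = \<chi> k * c ^ i" if "k \<in> K" for k and i :: nat
  proof -
    have "k \<otimes>\<^bsub>G\<^esub> a [^]\<^bsub>G\<^esub> i \<in> K'" using K' that by blast
    moreover have "(THE z. \<exists>l\<in>K. \<exists>j::nat. k \<otimes>\<^bsub>G\<^esub> a [^]\<^bsub>G\<^esub> i = l \<otimes>\<^bsub>G\<^esub> a [^]\<^bsub>G\<^esub> j \<and> z = \<chi> l * c ^ j) = \<chi> k * c ^ i"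
      using that by (intro the_equality) (auto intro: well_defined)
    ultimately show ?thesis by (simp add: \<chi>'_def)
  qed
  have "\<chi>' \<in> carrier (dual_group (G\<lparr>carrier := K'\<rparr>))"
  proof -
    have "\<chi>' x \<noteq> 0" if "x \<in> K'" for x
      using that \<chi>' nz \<open>c \<noteq> 0\<close> by (auto simp: K')
    moreover have "\<chi>' (x \<otimes>\<^bsub>G\<^esub> y) = \<chi>' x * \<chi>' y" if "x \<in> K'" "y \<in> K'" for x y
    proof -
      from that obtain k l and i j :: nat where
        "k \<in> K" "x = k \<otimes>\<^bsub>G\<^esub> a [^]\<^bsub>G\<^esub> i" "l \<in> K" "y = l \<otimes>\<^bsub>G\<^esub> a [^]\<^bsub>G\<^esub> j"
        by (auto simp: K')
      moreover from this have "x \<otimes>\<^bsub>G\<^esub> y = (k \<otimes>\<^bsub>G\<^esub> l) \<otimes>\<^bsub>G\<^esub> a [^]\<^bsub>G\<^esub> (i + j)"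
        using a by (simp add: G.nat_pow_mult[symmetric] G.m_ac)
      ultimately show ?thesis
        by (simp add: \<chi>' mul power_add)
    qed
    ultimately show ?thesis by (simp add: dual_group_iff \<chi>'_def)
  qed
  moreover have "insert a K \<subseteq> K'"
  proof -
    have "x \<in> K'" if "x \<in> K" for x
      using that by (auto simp: K' intro!: bexI[of _ x] exI[of _ "0::nat"])
    moreover have "a \<in> K'"
      using a by (auto simp: K' intro!: bexI[of _ "\<one>\<^bsub>G\<^esub>"] exI[of _ "1::nat"])
    ultimately show ?thesis by blast
  qed
  moreover have "\<chi>' x = \<chi> x" if "x \<in> K" for x
    using \<chi>'[OF that, of 0] that by simp
  moreover have "\<chi>' a = c"
    using \<chi>'[OF K.one_closed, of 1] a one by simp
  ultimately show thesis using sub that by blast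
qed

lemma least_power_in_subgroup:
  assumes "Group.group G" "finite (carrier G)" "subgroup K G" "a \<in> carrier G"
  obtains m :: nat where "0 < m" "a [^]\<^bsub>G\<^esub> m \<in> K" "\<And>i. \<lbrakk>0 < i; a [^]\<^bsub>G\<^esub> i \<in> K\<rbrakk> \<Longrightarrow> m \<le> (i::nat)"
proof -
  interpret Group.group G by fact
  let ?P = "\<lambda>i::nat. 0 < i \<and> a [^]\<^bsub>G\<^esub> i \<in> K"
  have "?P (Coset.order G)"
    using assms by (simp add: pow_order_eq_1 order_gt_0_iff_finite subgroup.one_closed)
  from LeastI[of ?P, OF this] show thesis
    by (intro that[of "LEAST i. ?P i"]) (auto intro: Least_le)
qed

text \<open>
  Adjoin the elements of the group one after another: since \<open>\<complex>\<close> contains all roots, a value for the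
  new element can always be chosen.
\<close>

lemma character_extension:
  fixes G :: "('a, 'b) monoid_scheme"
  assumes "Group.comm_group G" "finite (carrier G)"
    and "subgroup K G" "\<chi> \<in> carrier (dual_group (G\<lparr>carrier := K\<rparr>))"
  obtains \<psi> where "\<psi> \<in> carrier (dual_group G)" "\<And>x. x \<in> K \<Longrightarrow> \<psi> x = \<chi> x"
proof -
  interpret G: Group.comm_group G by fact
  have "\<exists>\<psi>\<in>carrier (dual_group G). \<forall>x\<in>K. \<psi> x = \<chi> x"
    using assms(3,4)
  proof (induction "card (carrier G - K)" arbitrary: K \<chi> rule: less_induct)
    case less
    have KG: "K \<subseteq> carrier G" using less.prems(1) by (rule subgroup.subset)
    show ?case
    proof (cases "K = carrier G")
      case True
      then have "dual_group (G\<lparr>carrier := K\<rparr>) = dual_group G"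
        by (simp add: dual_group_def hom_def)
      with less.prems show ?thesis by auto
    next
      case False
      with KG obtain a where a: "a \<in> carrier G" "a \<notin> K" by blast
      obtain m :: nat where m: "0 < m" "a [^]\<^bsub>G\<^esub> m \<in> K"
        "\<And>i. \<lbrakk>0 < i; a [^]\<^bsub>G\<^esub> i \<in> K\<rbrakk> \<Longrightarrow> m \<le> (i::nat)"
        using least_power_in_subgroup[OF G.group_axioms assms(2) less.prems(1) a(1)] by blast
      have "\<chi> (a [^]\<^bsub>G\<^esub> m) \<noteq> 0"
        using character_nonzero[OF less.prems(2)] m(2) by simp
      then have "card {z. z ^ m = \<chi> (a [^]\<^bsub>G\<^esub> m)} = m"
        using m(1) by (rule card_nth_roots)
      then have "{z. z ^ m = \<chi> (a [^]\<^bsub>G\<^esub> m)} \<noteq> {}"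
        using m(1) by (metis card.empty less_irrefl)
      then obtain c where "c ^ m = \<chi> (a [^]\<^bsub>G\<^esub> m)" by blast
      then obtain K' \<chi>' where K': "subgroup K' G" "insert a K \<subseteq> K'"
        "\<chi>' \<in> carrier (dual_group (G\<lparr>carrier := K'\<rparr>))" "\<And>x. x \<in> K \<Longrightarrow> \<chi>' x = \<chi> x"
        using extend_character_by_element[OF assms(1,2) less.prems(1) a(1) less.prems(2) m] by metis
      have "card (carrier G - K') < card (carrier G - K)"
        using a K'(2) assms(2) by (intro psubset_card_mono) auto
      from less.hyps[OF this K'(1,3)] obtain \<psi> where "\<psi> \<in> carrier (dual_group G)" "\<forall>x\<in>K'. \<psi> x = \<chi>' x"
        by blast
      with K'(2,4) show ?thesis by (intro bexI[of _ \<psi>]) auto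
    qed
  qed
  then show thesis using that by blast
qed

text \<open>
  Start from the trivial subgroup: the minimal exponent \<open>m\<close> is the order of \<open>a\<close>, and \<open>a\<close> may be sent
  to any \<open>m\<close>-th root of unity, so to one that differs from 1.
\<close>

lemma characters_separate_points:
  fixes G :: "('a, 'b) monoid_scheme"
  assumes "Group.comm_group G" "finite (carrier G)" "a \<in> carrier G" "a \<noteq> \<one>\<^bsub>G\<^esub>"
  obtains \<psi> where "\<psi> \<in> carrier (dual_group G)" "\<psi> a \<noteq> 1"
proof -
  interpret G: Group.comm_group G by fact
  let ?K = "{\<one>\<^bsub>G\<^esub>}"
  let ?\<chi> = "\<lambda>x\<in>?K. 1 :: complex"
  have K: "subgroup ?K G" by (rule G.triv_subgroup)
  have \<chi>: "?\<chi> \<in> carrier (dual_group (G\<lparr>carrier := ?K\<rparr>))"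
    by (simp add: dual_group_iff)
  obtain m :: nat where m: "0 < m" "a [^]\<^bsub>G\<^esub> m \<in> ?K"
    "\<And>i. \<lbrakk>0 < i; a [^]\<^bsub>G\<^esub> i \<in> ?K\<rbrakk> \<Longrightarrow> m \<le> (i::nat)"
    using least_power_in_subgroup[OF G.group_axioms assms(2) K assms(3)] by blast
  have "m \<noteq> 1" using m(2) assms(3,4) by auto
  have "\<exists>c::complex. c ^ m = 1 \<and> c \<noteq> 1"
  proof (rule ccontr)
    assume "\<not> ?thesis"
    then have "{z::complex. z ^ m = 1} \<subseteq> {1}" by auto
    then have "card {z::complex. z ^ m = 1} \<le> card {1::complex}"
      by (intro card_mono) auto
    with card_roots_unity_eq[OF m(1)] m(1) \<open>m \<noteq> 1\<close> show False by simp
  qed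
  then obtain c :: complex where c: "c ^ m = ?\<chi> (a [^]\<^bsub>G\<^esub> m)" "c \<noteq> 1"
    using m(2) by auto
  obtain K' \<chi>' where K': "subgroup K' G" "insert a ?K \<subseteq> K'"
    "\<chi>' \<in> carrier (dual_group (G\<lparr>carrier := K'\<rparr>))" "\<chi>' a = c"
    using extend_character_by_element[OF assms(1,2) K assms(3) \<chi> m c(1)] by metis
  obtain \<psi> where "\<psi> \<in> carrier (dual_group G)" "\<And>x. x \<in> K' \<Longrightarrow> \<psi> x = \<chi>' x"
    using character_extension[OF assms(1,2) K'(1,3)] by blast
  with K' c(2) show thesis by (intro that[of \<psi>]) auto
qed

text \<open>
  Translation by \<open>a\<close> permutes the summands and multiplies the sum by \<open>\<sigma> a\<close>. Applied to a group and to
  its dual, this gives both orthogonality relations.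
\<close>

lemma sum_hom_eq_0:
  fixes \<sigma> :: "'a \<Rightarrow> complex"
  assumes "Group.group S" "\<And>x y. \<lbrakk>x \<in> carrier S; y \<in> carrier S\<rbrakk> \<Longrightarrow> \<sigma> (x \<otimes>\<^bsub>S\<^esub> y) = \<sigma> x * \<sigma> y"
    and "a \<in> carrier S" "\<sigma> a \<noteq> 1"
  shows "(\<Sum>x\<in>carrier S. \<sigma> x) = 0"
proof -
  interpret Group.group S by fact
  have "bij_betw (\<lambda>x. a \<otimes>\<^bsub>S\<^esub> x) (carrier S) (carrier S)"
    using assms(3) by (intro bij_betw_byWitness[where f' = "\<lambda>x. inv\<^bsub>S\<^esub> a \<otimes>\<^bsub>S\<^esub> x"])
      (auto simp: m_assoc[symmetric])
  then have "(\<Sum>x\<in>carrier S. \<sigma> x) = (\<Sum>x\<in>carrier S. \<sigma> (a \<otimes>\<^bsub>S\<^esub> x))"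
    by (rule sum.reindex_bij_betw[symmetric])
  also have "\<dots> = \<sigma> a * (\<Sum>x\<in>carrier S. \<sigma> x)"
    using assms by (simp add: sum_distrib_left)
  finally show ?thesis using assms(4) by simp
qed

lemma sum_over_dual_group:
  assumes "Group.comm_group S" "finite (carrier S)" "x \<in> carrier S"
  shows "(\<Sum>\<chi>\<in>carrier (dual_group S). \<chi> x) =
    (if x = \<one>\<^bsub>S\<^esub> then of_nat (card (carrier (dual_group S))) else 0)"
proof -
  interpret Group.comm_group S by fact
  interpret D: Group.comm_group "dual_group S" 
    by (rule comm_group_dual_group[OF group_axioms])
  show ?thesis
  proof (cases "x = \<one>\<^bsub>S\<^esub>")
    case True
    then show ?thesis by (simp add: character_one[OF group_axioms])
  next
    case False
    then obtain \<psi> where "\<psi> \<in> carrier (dual_group S)" "\<psi> x \<noteq> 1"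
      using characters_separate_points[OF assms] by blast
    with False show ?thesis
      using sum_hom_eq_0[OF D.group_axioms, of "\<lambda>\<chi>. \<chi> x"] assms(3) by simp
  qed
qed

lemma sum_character_quotient:
  assumes "Group.group S" "\<chi> \<in> carrier (dual_group S)" "\<psi> \<in> carrier (dual_group S)"
  shows "(\<Sum>x\<in>carrier S. \<chi> x * \<psi> (inv\<^bsub>S\<^esub> x)) = (if \<chi> = \<psi> then of_nat (card (carrier S)) else 0)"
proof -
  interpret Group.group S by fact
  have eq: "\<psi> (inv\<^bsub>S\<^esub> x) = inverse (\<psi> x)" if "x \<in> carrier S" for x
    using that by (rule character_inv[OF assms(1,3)])
  show ?thesis
  proof (cases "\<chi> = \<psi>")
    case True
    then show ?thesis using assms by (simp add: eq character_nonzero)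
  next
    case False
    with assms obtain a where a: "a \<in> carrier S" "\<chi> a \<noteq> \<psi> a"
      by (metis dual_group_iff extensionalityI)
    then have "\<chi> a * \<psi> (inv\<^bsub>S\<^esub> a) \<noteq> 1"
      using assms character_nonzero[OF assms(3), of a] by (simp add: eq field_simps)
    with a False show ?thesis
      using assms by (subst sum_hom_eq_0[OF assms(1)]) (auto simp: character_mult eq)
  qed
qed

text \<open>
  Evaluate \<open>\<Sum>\<chi>. \<Sum>x. \<chi> x\<close> in both orders: only the trivial character, respectively only the unit
  element, contributes.
\<close>

lemma card_dual_group:
  assumes "Group.comm_group S" "finite (carrier S)"
  shows "card (carrier (dual_group S)) = card (carrier S)"
proof -
  interpret Group.comm_group S by fact
  let ?D = "carrier (dual_group S)"
  have one: "\<one>\<^bsub>dual_group S\<^esub> \<in> ?D" by (simp add: dual_group_iff)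
  have fin: "finite ?D" by (rule finite_dual_group[OF group_axioms assms(2)])
  have "(\<Sum>x\<in>carrier S. \<chi> x) = (if \<chi> = \<one>\<^bsub>dual_group S\<^esub> then of_nat (card (carrier S)) else 0)"
    if "\<chi> \<in> ?D" for \<chi>
    using sum_character_quotient[OF group_axioms that one] by simp
  then have "(\<Sum>\<chi>\<in>?D. \<Sum>x\<in>carrier S. \<chi> x) = of_nat (card (carrier S))"
    using fin one by (simp add: sum.delta)
  moreover have "(\<Sum>\<chi>\<in>?D. \<Sum>x\<in>carrier S. \<chi> x) = of_nat (card ?D)"
    using assms by (subst sum.swap) (simp add: sum_over_dual_group sum.delta)
  ultimately show ?thesis by (metis of_nat_eq_iff)
qed

text \<open>
  The fibres of restriction are nonempty by the extension theorem, hence cosets of the group of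
  characters that are trivial on \<open>H\<close>. So they all have the same size, which a count of the
  characters of \<open>G\<close> and of \<open>H\<close> determines.
\<close>

lemma card_extensions_of_character:
  fixes G :: "('a, 'b) monoid_scheme"
  assumes "Group.comm_group G" "finite (carrier G)" "subgroup H G"
    and \<chi>: "\<chi> \<in> carrier (dual_group (G\<lparr>carrier := H\<rparr>))"
  shows "card {\<psi> \<in> carrier (dual_group G). restrict \<psi> H = \<chi>} = card (rcosets\<^bsub>G\<^esub> H)"
proof -
  interpret G: Group.comm_group G by fact
  interpret H: subgroup H G by fact
  interpret D: Group.comm_group "dual_group G"
    by (rule comm_group_dual_group[OF G.group_axioms])
  let ?S = "G\<lparr>carrier := H\<rparr>"
  let ?DG = "carrier (dual_group G)" and ?DH = "carrier (dual_group ?S)"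
  let ?F = "\<lambda>\<chi>. {\<psi> \<in> ?DG. restrict \<psi> H = \<chi>}"
  have S: "Group.comm_group ?S"
    by (rule comm_group_subgroup[OF assms(1,3)])
  have finH: "finite H" using H.subset assms(2) by (rule finite_subset)
  have finDG: "finite ?DG" by (rule finite_dual_group[OF G.group_axioms assms(2)])
  have res: "restrict \<psi> H \<in> ?DH" if "\<psi> \<in> ?DG" for \<psi>
    using that H.subset by (auto simp: dual_group_iff subset_iff)
  have fibre: "card (?F \<chi>) = card (?F (\<lambda>x\<in>H. 1))" if \<chi>: "\<chi> \<in> ?DH" for \<chi>
  proof -
    obtain \<psi> where \<psi>: "\<psi> \<in> ?DG" "\<And>x. x \<in> H \<Longrightarrow> \<psi> x = \<chi> x"
      using character_extension[OF assms(1-3) \<chi>] by blast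
    let ?\<psi>' = "\<lambda>x\<in>carrier G. inverse (\<psi> x)"
    have \<psi>': "?\<psi>' \<in> ?DG" by (rule inverse_character[OF G.group_axioms \<psi>(1)])
    have ext: "\<chi> \<in> extensional H" "\<And>x. x \<in> H \<Longrightarrow> \<chi> x \<noteq> 0" using \<chi> by (auto simp: dual_group_iff)
    have nz: "\<And>x. x \<in> carrier G \<Longrightarrow> \<psi> x \<noteq> 0" using \<psi> by (auto simp: dual_group_iff)
    have "bij_betw (\<lambda>\<phi>. \<psi> \<otimes>\<^bsub>dual_group G\<^esub> \<phi>) (?F (\<lambda>x\<in>H. 1)) (?F \<chi>)"
    proof (rule bij_betw_byWitness[where f' = "\<lambda>\<phi>. ?\<psi>' \<otimes>\<^bsub>dual_group G\<^esub> \<phi>"])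
      show "\<forall>\<phi>\<in>?F (\<lambda>x\<in>H. 1). ?\<psi>' \<otimes>\<^bsub>dual_group G\<^esub> (\<psi> \<otimes>\<^bsub>dual_group G\<^esub> \<phi>) = \<phi>"
        using nz by (auto simp: dual_group_iff intro!: extensionalityI[of _ "carrier G"])
      show "\<forall>\<phi>\<in>?F \<chi>. \<psi> \<otimes>\<^bsub>dual_group G\<^esub> (?\<psi>' \<otimes>\<^bsub>dual_group G\<^esub> \<phi>) = \<phi>"
        using nz by (auto simp: dual_group_iff intro!: extensionalityI[of _ "carrier G"])
      show "(\<lambda>\<phi>. \<psi> \<otimes>\<^bsub>dual_group G\<^esub> \<phi>) ` ?F (\<lambda>x\<in>H. 1) \<subseteq> ?F \<chi>"
      proof safe
        fix \<phi> assume \<phi>: "\<phi> \<in> ?DG" "restrict \<phi> H = (\<lambda>x\<in>H. 1)"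
        have "\<phi> x = 1" if "x \<in> H" for x using fun_cong[OF \<phi>(2), of x] that by simp
        then show "restrict (\<psi> \<otimes>\<^bsub>dual_group G\<^esub> \<phi>) H = \<chi>"
          using ext H.subset \<psi>(2) by (auto intro!: extensionalityI[of _ H])
      qed (use \<psi>(1) D.m_closed in blast)
      show "(\<lambda>\<phi>. ?\<psi>' \<otimes>\<^bsub>dual_group G\<^esub> \<phi>) ` ?F \<chi> \<subseteq> ?F (\<lambda>x\<in>H. 1)"
      proof safe
        fix \<phi> assume \<phi>: "\<phi> \<in> ?DG" "\<chi> = restrict \<phi> H"
        show "restrict (?\<psi>' \<otimes>\<^bsub>dual_group G\<^esub> \<phi>) H = (\<lambda>x\<in>H. 1)"
          using ext(2) H.subset \<psi>(2) \<phi>(2) by (auto intro!: restrict_ext)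
      qed (use \<psi>' D.m_closed in blast)
    qed
    then show ?thesis by (simp add: bij_betw_same_card)
  qed
  have "card ?DG = (\<Sum>\<chi>\<in>?DH. card (?F \<chi>))"
  proof -
    have "?DG = (\<Union>\<chi>\<in>?DH. ?F \<chi>)" using res by auto
    moreover have "card (\<Union>\<chi>\<in>?DH. ?F \<chi>) = (\<Sum>\<chi>\<in>?DH. card (?F \<chi>))"
      using finDG finite_dual_group[OF H.subgroup_is_group[OF G.group_axioms]] finH
      by (intro card_UN_disjoint) auto
    ultimately show ?thesis by (rule trans[OF arg_cong[where f = card]])
  qed
  also have "\<dots> = (\<Sum>\<chi>'\<in>?DH. card (?F \<chi>))"
    by (intro sum.cong refl) (simp add: fibre \<chi>)
  finally have "card (carrier G) = card H * card (?F \<chi>)"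
    using card_dual_group[OF assms(1,2)] card_dual_group[OF S] finH by simp
  moreover have "card (rcosets\<^bsub>G\<^esub> H) * card H = card (carrier G)"
    using G.lagrange[OF assms(3)] by (simp add: Coset.order_def)
  moreover have "0 < card H" using finH H.one_closed by (metis card_gt_0_iff empty_iff)
  ultimately show ?thesis by (simp add: mult.commute)
qed

section \<open>The Dedekind factorization of the group determinant\<close>

text \<open>
  Similar matrices have equal determinants, over a commutative ring with zero divisors: \<open>det P\<close> can
  be cancelled because the hypotheses on \<open>Q\<close> make it a unit.
\<close>

lemma det_eq_of_mult_eq:
  fixes M D P Q :: "'r::comm_ring_1 mat"
  assumes "M \<in> carrier_mat n n" "D \<in> carrier_mat n n" "P \<in> carrier_mat n n" "Q \<in> carrier_mat n n"
    and "M * P = P * D" "P * Q = c \<cdot>\<^sub>m 1\<^sub>m n" "c * d = 1"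
  shows "det M = det D"
proof -
  have PQ: "det P * det Q = c ^ n"
    using assms by (metis det_mult det_one det_smult index_one_mat(2) index_one_mat(3) carrier_matI mult.right_neutral)
  have "det M * det P = det D * det P"
    using assms by (metis det_mult mult.commute)
  then have "det M * (det P * det Q) = det D * (det P * det Q)"
    by (metis mult.assoc)
  then have "det M * (c ^ n * d ^ n) = det D * (c ^ n * d ^ n)"
    unfolding PQ by (metis mult.assoc)
  moreover have "c ^ n * d ^ n = 1"
    using assms(7) by (simp add: power_mult_distrib[symmetric])
  ultimately show ?thesis by simp
qed

text \<open>
  Dedekind's theorem. The vectors of character values diagonalize the group matrix, and there are
  enough of them because a finite abelian group has as many characters as elements.
\<close>

lemma group_determinant_eq_prod:
  fixes G :: "('a, 'b) monoid_scheme"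
  assumes "Group.comm_group G" "finite (carrier G)"
  shows "group_determinant G =
    (\<Prod>\<chi>\<in>carrier (dual_group G). \<Sum>g\<in>carrier G. pconst (\<chi> g) * pvar g)"
proof -
  interpret G: Group.comm_group G by fact
  let ?n = "card (carrier G)"
  define L where "L = (\<lambda>\<chi>. \<Sum>g\<in>carrier G. pconst (\<chi> g) * pvar g)"
  define f where "f = (SOME f. bij_betw f {0..<?n} (carrier G))"
  have f: "bij_betw f {0..<?n} (carrier G)"
    unfolding f_def by (rule someI_ex[OF ex_bij_betw_nat_finite[OF assms(2)]])
  have fG: "f i \<in> carrier G" if "i < ?n" for i
    using bij_betwE[OF f] that by simp
  have f_eq: "f i = f j \<longleftrightarrow> i = j" if "i < ?n" "j < ?n" for i j
    using f that by (auto simp: bij_betw_def inj_on_def)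
  have fin: "finite (carrier (dual_group G))" by (rule finite_dual_group[OF G.group_axioms assms(2)])
  have card: "card (carrier (dual_group G)) = ?n" by (rule card_dual_group[OF assms])
  obtain e where e: "bij_betw e {0..<?n} (carrier (dual_group G))"
    using ex_bij_betw_nat_finite[OF fin] card by auto
  have eD: "e k \<in> carrier (dual_group G)" if "k < ?n" for k
    using bij_betwE[OF e] that by simp
  \<comment> \<open>Up to the factor \<open>\<chi> (f i)\<inverse>\<close>, each row of the matrix \<open>M\<close> applied to the vector of values
    \<open>\<chi> (f j)\<inverse>\<close> gives the same linear form in the variables: these vectors, the columns of \<open>P\<close>,
    are eigenvectors. Up to a scalar, the character table \<open>Q\<close> is the inverse of \<open>P\<close>.\<close>
  define M where "M = mat ?n ?n (\<lambda>(i, j). pvar (f i \<otimes>\<^bsub>G\<^esub> inv\<^bsub>G\<^esub> (f j)))"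
  define P where "P = mat ?n ?n (\<lambda>(j, k). pconst (e k (inv\<^bsub>G\<^esub> (f j))) :: 'a cpoly)"
  define Q where "Q = mat ?n ?n (\<lambda>(k, j). pconst (e k (f j)) :: 'a cpoly)"
  define D where "D = mat ?n ?n (\<lambda>(k, l). if k = l then L (e k) else 0)"
  have MP: "M * P = P * D"
  proof (rule eq_matI)
    fix i k assume "i < dim_row (P * D)" "k < dim_col (P * D)"
    then have ik: "i < ?n" "k < ?n" by (simp_all add: P_def D_def)
    let ?\<chi> = "e k" and ?x = "f i"
    \<comment> \<open>Substituting \<open>h = g\<inverse> x\<close> turns the index \<open>x h\<inverse>\<close> of the variable into \<open>g\<close>.\<close>
    have bij: "bij_betw (\<lambda>g. inv\<^bsub>G\<^esub> g \<otimes>\<^bsub>G\<^esub> ?x) (carrier G) (carrier G)"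
      using fG[OF ik(1)]
      by (intro bij_betw_byWitness[where f' = "\<lambda>h. ?x \<otimes>\<^bsub>G\<^esub> inv\<^bsub>G\<^esub> h"])
        (auto simp: G.inv_mult_group G.m_assoc[symmetric], simp_all add: G.m_assoc)
    have "(M * P) $$ (i, k) =
        (\<Sum>j = 0..<?n. pvar (?x \<otimes>\<^bsub>G\<^esub> inv\<^bsub>G\<^esub> (f j)) * pconst (?\<chi> (inv\<^bsub>G\<^esub> (f j))))"
      using ik by (simp add: M_def P_def scalar_prod_def)
    also have "\<dots> = (\<Sum>h\<in>carrier G. pvar (?x \<otimes>\<^bsub>G\<^esub> inv\<^bsub>G\<^esub> h) * pconst (?\<chi> (inv\<^bsub>G\<^esub> h)))"
      by (rule sum.reindex_bij_betw[OF f])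
    also have "\<dots> = (\<Sum>g\<in>carrier G. pvar (?x \<otimes>\<^bsub>G\<^esub> inv\<^bsub>G\<^esub> (inv\<^bsub>G\<^esub> g \<otimes>\<^bsub>G\<^esub> ?x)) *
        pconst (?\<chi> (inv\<^bsub>G\<^esub> (inv\<^bsub>G\<^esub> g \<otimes>\<^bsub>G\<^esub> ?x))))"
      by (rule sum.reindex_bij_betw[OF bij, symmetric])
    also have "\<dots> = (\<Sum>g\<in>carrier G. pconst (?\<chi> (inv\<^bsub>G\<^esub> ?x)) * (pconst (?\<chi> g) * pvar g))"
    proof (rule sum.cong[OF refl])
      fix g assume g: "g \<in> carrier G"
      have inv: "inv\<^bsub>G\<^esub> (inv\<^bsub>G\<^esub> g \<otimes>\<^bsub>G\<^esub> ?x) = inv\<^bsub>G\<^esub> ?x \<otimes>\<^bsub>G\<^esub> g"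
        using g fG[OF ik(1)] by (simp add: G.inv_mult_group)
      show "pvar (?x \<otimes>\<^bsub>G\<^esub> inv\<^bsub>G\<^esub> (inv\<^bsub>G\<^esub> g \<otimes>\<^bsub>G\<^esub> ?x)) * pconst (?\<chi> (inv\<^bsub>G\<^esub> (inv\<^bsub>G\<^esub> g \<otimes>\<^bsub>G\<^esub> ?x))) =
          pconst (?\<chi> (inv\<^bsub>G\<^esub> ?x)) * (pconst (?\<chi> g) * pvar g)"
        using g fG[OF ik(1)] eD[OF ik(2)] unfolding inv
        by (simp add: G.m_assoc[symmetric] character_mult pconst_mult mult_ac)
    qed
    also have "\<dots> = pconst (?\<chi> (inv\<^bsub>G\<^esub> ?x)) * L ?\<chi>"
      by (simp add: L_def sum_distrib_left)
    also have "\<dots> = (P * D) $$ (i, k)"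
      using ik by (simp add: P_def D_def scalar_prod_def if_distrib[of "\<lambda>z. _ * z"] sum.delta cong: if_cong)
    finally show "(M * P) $$ (i, k) = (P * D) $$ (i, k)" .
  qed (simp_all add: M_def P_def D_def)
  have PQ: "P * Q = pconst (of_nat ?n) \<cdot>\<^sub>m 1\<^sub>m ?n"
  proof (rule eq_matI)
    fix i j assume "i < dim_row (pconst (of_nat ?n) \<cdot>\<^sub>m 1\<^sub>m ?n)" "j < dim_col (pconst (of_nat ?n) \<cdot>\<^sub>m 1\<^sub>m ?n)"
    then have ij: "i < ?n" "j < ?n" by simp_all
    have "(P * Q) $$ (i, j) = (\<Sum>k = 0..<?n. pconst (e k (inv\<^bsub>G\<^esub> (f i) \<otimes>\<^bsub>G\<^esub> f j)))"
      using ij fG eD by (simp add: P_def Q_def scalar_prod_def character_mult pconst_mult)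
    also have "\<dots> = (\<Sum>\<chi>\<in>carrier (dual_group G). pconst (\<chi> (inv\<^bsub>G\<^esub> (f i) \<otimes>\<^bsub>G\<^esub> f j)))"
      by (rule sum.reindex_bij_betw[OF e])
    also have "\<dots> = pconst (if inv\<^bsub>G\<^esub> (f i) \<otimes>\<^bsub>G\<^esub> f j = \<one>\<^bsub>G\<^esub> then of_nat ?n else 0)"
      using ij fG by (simp add: pconst_sum[symmetric] sum_over_dual_group[OF assms] card)
    also have "inv\<^bsub>G\<^esub> (f i) \<otimes>\<^bsub>G\<^esub> f j = \<one>\<^bsub>G\<^esub> \<longleftrightarrow> i = j"
      using fG[OF ij(1)] fG[OF ij(2)] f_eq[OF ij]
      by (metis G.inv_closed G.inv_solve_left G.one_closed G.r_one)
    finally show "(P * Q) $$ (i, j) = (pconst (of_nat ?n) \<cdot>\<^sub>m 1\<^sub>m ?n) $$ (i, j)"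
      using ij by simp
  qed (simp_all add: P_def Q_def)
  have "?n \<noteq> 0" using assms(2) G.one_closed by (metis card_0_eq empty_iff)
  then have "pconst (of_nat ?n) * pconst (1 / of_nat ?n) = (1 :: 'a cpoly)"
    by (simp add: pconst_mult[symmetric])
  then have "det M = det D"
    using MP PQ by (intro det_eq_of_mult_eq[of M ?n D P Q]) (simp_all add: M_def D_def P_def Q_def)
  also have "\<dots> = prod_list (diag_mat D)"
    by (rule det_upper_triangular[of _ ?n]) (auto simp: D_def upper_triangular_def)
  also have "\<dots> = (\<Prod>k = 0..<?n. L (e k))"
    by (simp add: prod_list_diag_prod D_def)
  also have "\<dots> = (\<Prod>\<chi>\<in>carrier (dual_group G). L \<chi>)"
    by (rule prod.reindex_bij_betw[OF e])
  finally show ?thesis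
    by (simp add: group_determinant_def Let_def M_def f_def L_def)
qed

section \<open>Fourier transforms on group algebras\<close>

text \<open>
  This is the value of the algebra homomorphism that extends the character linearly to the group
  algebra.
\<close>

definition fourier :: "('a, 'b) monoid_scheme \<Rightarrow> ('a \<Rightarrow> complex) \<Rightarrow> ('a \<Rightarrow> 'c cpoly) \<Rightarrow> 'c cpoly" where
  "fourier S \<chi> f = (\<Sum>x\<in>carrier S. pconst (\<chi> x) * f x)"

definition inverse_fourier ::
  "('a, 'b) monoid_scheme \<Rightarrow> (('a \<Rightarrow> complex) \<Rightarrow> 'c cpoly) \<Rightarrow> 'a \<Rightarrow> 'c cpoly" where
  "inverse_fourier S F x =
     pconst (1 / of_nat (card (carrier S))) *
       (\<Sum>\<chi>\<in>carrier (dual_group S). pconst (\<chi> (inv\<^bsub>S\<^esub> x)) * F \<chi>)"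

lemma pconst_card_inverse:
  assumes "Group.group S" "finite (carrier S)"
  shows "pconst (1 / of_nat (card (carrier S))) * (pconst (of_nat (card (carrier S))) * p) = p"
proof -
  interpret Group.group S by fact
  have "card (carrier S) \<noteq> 0" using assms(2) one_closed by (metis card_0_eq empty_iff)
  then show ?thesis by (simp add: mult.assoc[symmetric] pconst_mult[symmetric])
qed

text \<open>
  Orthogonality in the variable \<open>\<chi>\<close>: it holds because characters separate the points of the group.
\<close>

lemma inverse_fourier_fourier:
  assumes "Group.comm_group S" "finite (carrier S)" and x: "x \<in> carrier S"
  shows "inverse_fourier S (\<lambda>\<chi>. fourier S \<chi> f) x = f x"
proof -
  interpret Group.comm_group S by fact
  have "(\<Sum>\<chi>\<in>carrier (dual_group S). pconst (\<chi> (inv\<^bsub>S\<^esub> x)) * fourier S \<chi> f) =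
      (\<Sum>y\<in>carrier S. \<Sum>\<chi>\<in>carrier (dual_group S). pconst (\<chi> (inv\<^bsub>S\<^esub> x \<otimes>\<^bsub>S\<^esub> y)) * f y)"
    using x unfolding fourier_def sum_distrib_left
    by (subst sum.swap) (simp add: character_mult pconst_mult mult.assoc)
  also have "\<dots> = (\<Sum>y\<in>carrier S. pconst (if y = x then of_nat (card (carrier S)) else 0) * f y)"
  proof (rule sum.cong[OF refl])
    fix y assume y: "y \<in> carrier S"
    have "inv\<^bsub>S\<^esub> x \<otimes>\<^bsub>S\<^esub> y = \<one>\<^bsub>S\<^esub> \<longleftrightarrow> y = x"
      using x y by (metis inv_closed inv_solve_left one_closed r_one)
    then show "(\<Sum>\<chi>\<in>carrier (dual_group S). pconst (\<chi> (inv\<^bsub>S\<^esub> x \<otimes>\<^bsub>S\<^esub> y)) * f y) =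
        pconst (if y = x then of_nat (card (carrier S)) else 0) * f y"
      using x y assms
      by (simp add: sum_distrib_right[symmetric] pconst_sum[symmetric] sum_over_dual_group card_dual_group)
  qed
  also have "\<dots> = pconst (of_nat (card (carrier S))) * f x"
    using x assms(2) by (simp add: if_distrib[of pconst] if_distrib[of "\<lambda>z. z * _"] sum.delta cong: if_cong)
  finally show ?thesis
    using pconst_card_inverse[OF group_axioms assms(2)] by (simp add: inverse_fourier_def)
qed

text \<open>
  Orthogonality in the variable \<open>x\<close>. It makes every family of polynomials indexed by the characters a
  family of Fourier transforms.
\<close>

lemma fourier_inverse_fourier:
  assumes "Group.comm_group S" "finite (carrier S)" and \<chi>: "\<chi> \<in> carrier (dual_group S)"
  shows "fourier S \<chi> (inverse_fourier S F) = F \<chi>"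
proof -
  interpret Group.comm_group S by fact
  let ?c = "pconst (1 / of_nat (card (carrier S)))"
  have fin: "finite (carrier (dual_group S))" by (rule finite_dual_group[OF group_axioms assms(2)])
  have "fourier S \<chi> (inverse_fourier S F) =
      ?c * (\<Sum>\<psi>\<in>carrier (dual_group S). \<Sum>x\<in>carrier S. pconst (\<chi> x * \<psi> (inv\<^bsub>S\<^esub> x)) * F \<psi>)"
    unfolding fourier_def inverse_fourier_def sum_distrib_left
    by (subst sum.swap) (simp add: pconst_mult mult_ac)
  also have "(\<Sum>\<psi>\<in>carrier (dual_group S). \<Sum>x\<in>carrier S. pconst (\<chi> x * \<psi> (inv\<^bsub>S\<^esub> x)) * F \<psi>) =
      (\<Sum>\<psi>\<in>carrier (dual_group S). pconst (if \<chi> = \<psi> then of_nat (card (carrier S)) else 0) * F \<psi>)"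
    by (intro sum.cong refl)
      (simp add: sum_distrib_right[symmetric] pconst_sum[symmetric]
        sum_character_quotient[OF group_axioms \<chi>])
  also have "\<dots> = pconst (of_nat (card (carrier S))) * F \<chi>"
    using \<chi> fin by (simp add: if_distrib[of pconst] if_distrib[of "\<lambda>z. z * _"] sum.delta' cong: if_cong)
  finally show ?thesis
    using pconst_card_inverse[OF group_axioms assms(2)] by simp
qed

text \<open>
  An identity in the group algebra may thus be checked on Fourier transforms, where the convolution
  product becomes the product of polynomials.
\<close>

lemma fourier_eq_imp_eq:
  assumes "Group.comm_group S" "finite (carrier S)"
    and "f \<in> extensional (carrier S)" "g \<in> extensional (carrier S)"
    and eq: "\<And>\<chi>. \<chi> \<in> carrier (dual_group S) \<Longrightarrow> fourier S \<chi> f = fourier S \<chi> g"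
  shows "f = g"
  using assms(3,4)
proof (rule extensionalityI)
  fix x assume x: "x \<in> carrier S"
  have "inverse_fourier S (\<lambda>\<chi>. fourier S \<chi> f) x = inverse_fourier S (\<lambda>\<chi>. fourier S \<chi> g) x"
    by (simp add: inverse_fourier_def eq)
  then show "f x = g x"
    using inverse_fourier_fourier[OF assms(1,2) x] by metis
qed

lemma group_algebra_simps:
  "carrier (group_algebra R S) = carrier S \<rightarrow>\<^sub>E carrier R"
  "f \<oplus>\<^bsub>group_algebra R S\<^esub> g = (\<lambda>x\<in>carrier S. f x \<oplus>\<^bsub>R\<^esub> g x)"
  "\<zero>\<^bsub>group_algebra R S\<^esub> = (\<lambda>x\<in>carrier S. \<zero>\<^bsub>R\<^esub>)"
  "\<one>\<^bsub>group_algebra R S\<^esub> = group_algebra_term R S \<one>\<^bsub>R\<^esub> \<one>\<^bsub>S\<^esub>"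
  by (simp_all add: group_algebra_def group_algebra_term_def)

lemma group_algebra_mult:
  assumes "Group.group S"
    and "f \<in> carrier (group_algebra (cpoly_ring V) S)" "g \<in> carrier (group_algebra (cpoly_ring V) S)"
  shows "f \<otimes>\<^bsub>group_algebra (cpoly_ring V) S\<^esub> g =
    (\<lambda>x\<in>carrier S. \<Sum>y\<in>carrier S. f y * g (inv\<^bsub>S\<^esub> y \<otimes>\<^bsub>S\<^esub> x))"
proof -
  interpret Group.group S by fact
  have "f y * g (inv\<^bsub>S\<^esub> y \<otimes>\<^bsub>S\<^esub> x) \<in> carrier (cpoly_ring V)"
    if "x \<in> carrier S" "y \<in> carrier S" for x y
    using that assms(2,3) by (intro cpoly_carrier_mult) (auto simp: group_algebra_simps)
  then show ?thesis
    by (auto simp: group_algebra_def intro!: restrict_ext finsum_cpoly_ring)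
qed

lemma fourier_add:
  "fourier S \<chi> (f \<oplus>\<^bsub>group_algebra (cpoly_ring V) S\<^esub> g) = fourier S \<chi> f + fourier S \<chi> g"
  by (simp add: fourier_def group_algebra_simps distrib_left sum.distrib)

lemma fourier_term:
  assumes "finite (carrier S)" "s \<in> carrier S"
  shows "fourier S \<chi> (group_algebra_term (cpoly_ring V) S p s) = pconst (\<chi> s) * p"
  using assms
  by (simp add: fourier_def group_algebra_term_def if_distrib[of "\<lambda>z. _ * z"] sum.delta cong: if_cong)

lemma fourier_mult:
  assumes "Group.group S" and \<chi>: "\<chi> \<in> carrier (dual_group S)"
    and "f \<in> carrier (group_algebra (cpoly_ring V) S)" "g \<in> carrier (group_algebra (cpoly_ring V) S)"
  shows "fourier S \<chi> (f \<otimes>\<^bsub>group_algebra (cpoly_ring V) S\<^esub> g) = fourier S \<chi> f * fourier S \<chi> g"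
proof -
  interpret Group.group S by fact
  have "fourier S \<chi> (f \<otimes>\<^bsub>group_algebra (cpoly_ring V) S\<^esub> g) =
      (\<Sum>y\<in>carrier S. \<Sum>x\<in>carrier S. pconst (\<chi> x) * (f y * g (inv\<^bsub>S\<^esub> y \<otimes>\<^bsub>S\<^esub> x)))"
    by (subst sum.swap) (simp add: group_algebra_mult[OF assms(1,3,4)] fourier_def sum_distrib_left)
  also have "\<dots> = (\<Sum>y\<in>carrier S. \<Sum>z\<in>carrier S. pconst (\<chi> y) * f y * (pconst (\<chi> z) * g z))"
  proof (rule sum.cong[OF refl])
    fix y assume y: "y \<in> carrier S"
    have "bij_betw (\<lambda>z. y \<otimes>\<^bsub>S\<^esub> z) (carrier S) (carrier S)"
      using y by (intro bij_betw_byWitness[where f' = "\<lambda>x. inv\<^bsub>S\<^esub> y \<otimes>\<^bsub>S\<^esub> x"])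
        (auto simp: m_assoc[symmetric])
    then have "(\<Sum>x\<in>carrier S. pconst (\<chi> x) * (f y * g (inv\<^bsub>S\<^esub> y \<otimes>\<^bsub>S\<^esub> x))) =
        (\<Sum>z\<in>carrier S. pconst (\<chi> (y \<otimes>\<^bsub>S\<^esub> z)) * (f y * g (inv\<^bsub>S\<^esub> y \<otimes>\<^bsub>S\<^esub> (y \<otimes>\<^bsub>S\<^esub> z))))"
      by (rule sum.reindex_bij_betw[symmetric])
    also have "\<dots> = (\<Sum>z\<in>carrier S. pconst (\<chi> y) * f y * (pconst (\<chi> z) * g z))"
      using y by (intro sum.cong refl) (simp add: character_mult[OF \<chi>] pconst_mult m_assoc[symmetric] mult_ac)
    finally show "(\<Sum>x\<in>carrier S. pconst (\<chi> x) * (f y * g (inv\<^bsub>S\<^esub> y \<otimes>\<^bsub>S\<^esub> x))) =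
        (\<Sum>z\<in>carrier S. pconst (\<chi> y) * f y * (pconst (\<chi> z) * g z))" .
  qed
  finally show ?thesis by (simp add: fourier_def sum_product)
qed

lemma group_algebra_term_closed:
  "p \<in> carrier (cpoly_ring V) \<Longrightarrow>
    group_algebra_term (cpoly_ring V) S p s \<in> carrier (group_algebra (cpoly_ring V) S)"
  by (simp add: group_algebra_term_def group_algebra_simps cpoly_carrier_0)

text \<open>
  The axioms for the convolution product are inherited from the polynomial ring, since the Fourier
  transforms are multiplicative and jointly injective.
\<close>

lemma cring_group_algebra:
  assumes "Group.comm_group S" "finite (carrier S)"
  shows "cring (group_algebra (cpoly_ring V) S)" (is "cring ?A")
proof -
  interpret S: Group.comm_group S by fact
  note mult = fourier_mult[OF S.group_axioms]
  have ext: "f \<in> carrier ?A \<Longrightarrow> f \<in> extensional (carrier S)" for f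
    by (auto simp: group_algebra_simps PiE_iff)
  have eqI: "f = g" if "f \<in> carrier ?A" "g \<in> carrier ?A"
    "\<And>\<chi>. \<chi> \<in> carrier (dual_group S) \<Longrightarrow> fourier S \<chi> f = fourier S \<chi> g" for f g
    using fourier_eq_imp_eq[OF assms ext[OF that(1)] ext[OF that(2)] that(3)] .
  have add_closed: "f \<oplus>\<^bsub>?A\<^esub> g \<in> carrier ?A" if "f \<in> carrier ?A" "g \<in> carrier ?A" for f g
    using that by (auto simp: group_algebra_simps intro!: cpoly_carrier_add)
  have mult_closed: "f \<otimes>\<^bsub>?A\<^esub> g \<in> carrier ?A" if "f \<in> carrier ?A" "g \<in> carrier ?A" for f g
    using that unfolding group_algebra_mult[OF S.group_axioms that]
    by (auto simp: group_algebra_simps intro!: sum_cpoly_carrier cpoly_carrier_mult)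
  have one_closed: "\<one>\<^bsub>?A\<^esub> \<in> carrier ?A"
    by (simp add: group_algebra_simps(4) group_algebra_term_closed cpoly_carrier_1)
  have one: "fourier S \<chi> \<one>\<^bsub>?A\<^esub> = 1" if "\<chi> \<in> carrier (dual_group S)" for \<chi>
    using that assms(2) by (simp add: group_algebra_simps(4) fourier_term character_one[OF S.group_axioms])
  show ?thesis
  proof (rule cringI)
    show "abelian_group ?A"
    proof (rule abelian_groupI)
      show "\<exists>g\<in>carrier ?A. g \<oplus>\<^bsub>?A\<^esub> f = \<zero>\<^bsub>?A\<^esub>" if "f \<in> carrier ?A" for f
        using that
        by (intro bexI[of _ "\<lambda>x\<in>carrier S. - f x"])
          (auto simp: group_algebra_simps intro!: restrict_ext cpoly_carrier_uminus)
      show "\<zero>\<^bsub>?A\<^esub> \<oplus>\<^bsub>?A\<^esub> f = f" if "f \<in> carrier ?A" for f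
        using ext[OF that] by (auto simp: group_algebra_simps intro!: extensionalityI[of _ "carrier S"])
    qed (auto simp: add_closed, auto simp: group_algebra_simps cpoly_carrier_0 ac_simps intro!: restrict_ext)
    show "Group.comm_monoid ?A"
      by (rule comm_monoidI) (auto simp: mult_closed one_closed mult one mult_ac intro!: eqI)
  qed (auto simp: mult_closed add_closed mult fourier_add distrib_right intro!: eqI)
qed

lemma fourier_ring_hom:
  assumes "Group.comm_group S" "finite (carrier S)" "\<chi> \<in> carrier (dual_group S)"
  shows "ring_hom_cring (group_algebra (cpoly_ring V) S) (cpoly_ring V) (fourier S \<chi>)"
proof -
  interpret S: Group.comm_group S by fact
  show ?thesis
  proof (intro ring_hom_cring.intro ring_hom_cring_axioms.intro cring_group_algebra cring_cpoly_ring
      assms(1,2) ring_hom_memI)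
    show "fourier S \<chi> f \<in> carrier (cpoly_ring V)"
      if "f \<in> carrier (group_algebra (cpoly_ring V) S)" for f
      using that unfolding fourier_def
      by (auto simp: group_algebra_simps intro!: sum_cpoly_carrier cpoly_carrier_mult pconst_carrier)
  qed (use assms in \<open>simp_all add: fourier_mult[OF S.group_axioms] fourier_add group_algebra_simps(4)
        fourier_term character_one[OF S.group_axioms]\<close>)
qed

text \<open>
  The transform at \<open>\<phi>\<close> of the factor for \<open>\<chi>\<close> is the transform of \<open>A\<close> at \<open>\<phi> \<chi>\<close>. As \<open>\<chi>\<close> runs through
  the dual group, so does \<open>\<phi> \<chi>\<close>; hence the product has the same transform at all \<open>\<phi>\<close>, which
  characterizes the multiples of the unit.
\<close>

lemma group_algebra_factorization:
  fixes V S A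
  defines "R \<equiv> cpoly_ring V"
  assumes S: "Group.comm_group S" "finite (carrier S)" and A: "A \<in> carrier S \<rightarrow> carrier R"
  shows "group_algebra_term R S (\<Prod>\<chi>\<in>carrier (dual_group S). fourier S \<chi> A) \<one>\<^bsub>S\<^esub> =
    (\<Otimes>\<^bsub>group_algebra R S\<^esub> \<chi> \<in> carrier (dual_group S).
       \<Oplus>\<^bsub>group_algebra R S\<^esub> h \<in> carrier S. group_algebra_term R S (pconst (\<chi> h) * A h) h)"
    (is "?l = finprod ?RS ?F ?D")
proof -
  interpret S: Group.comm_group S by fact
  interpret D: Group.comm_group "dual_group S" by (rule comm_group_dual_group[OF S.group_axioms])
  interpret RS: cring ?RS unfolding R_def by (rule cring_group_algebra[OF S])
  have term_closed: "group_algebra_term R S (pconst (\<chi> h) * A h) h \<in> carrier ?RS"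
    if "h \<in> carrier S" for \<chi> h
    using that A unfolding R_def
    by (intro group_algebra_term_closed cpoly_carrier_mult pconst_carrier) auto
  then have F_closed: "?F \<chi> \<in> carrier ?RS" for \<chi>
    by (intro RS.finsum_closed) auto
  have trans_closed: "fourier S \<chi> A \<in> carrier R" for \<chi>
    using A unfolding R_def fourier_def 
    by (intro sum_cpoly_carrier cpoly_carrier_mult pconst_carrier) auto
  interpret R: cring R unfolding R_def by (rule cring_cpoly_ring)
  have l_closed: "?l \<in> carrier ?RS"
    using R.finprod_closed[of "\<lambda>\<chi>. fourier S \<chi> A" ?D] trans_closed 
    unfolding R_def by (intro group_algebra_term_closed) (simp add: finprod_cpoly_ring)
  show ?thesis
  proof (rule fourier_eq_imp_eq[OF S])
    show "?l \<in> extensional (carrier S)" "finprod ?RS ?F ?D \<in> extensional (carrier S)"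
      using l_closed RS.finprod_closed[of ?F ?D] F_closed by (auto simp: group_algebra_simps(1) PiE_iff)
  next
    fix \<phi> assume \<phi>: "\<phi> \<in> carrier (dual_group S)"
    interpret hom: ring_hom_cring ?RS R "fourier S \<phi>"
      unfolding R_def by (rule fourier_ring_hom[OF S \<phi>])
    have F: "fourier S \<phi> (?F \<chi>) = fourier S (\<phi> \<otimes>\<^bsub>dual_group S\<^esub> \<chi>) A" for \<chi>
    proof -
      have "fourier S \<phi> (?F \<chi>) =
          (\<Oplus>\<^bsub>R\<^esub> h\<in>carrier S. fourier S \<phi> (group_algebra_term R S (pconst (\<chi> h) * A h) h))"
        using term_closed by (subst hom.hom_finsum) (auto simp: comp_def)
      also have "\<dots> = (\<Sum>h\<in>carrier S. fourier S \<phi> (group_algebra_term R S (pconst (\<chi> h) * A h) h))"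
        using hom.hom_closed[OF term_closed] unfolding R_def by (intro finsum_cpoly_ring) auto
      also have "\<dots> = fourier S (\<phi> \<otimes>\<^bsub>dual_group S\<^esub> \<chi>) A"
        unfolding fourier_def[of S "\<phi> \<otimes>\<^bsub>dual_group S\<^esub> \<chi>"] R_def using S(2)
        by (intro sum.cong refl) (simp add: fourier_term pconst_mult mult_ac)
      finally show ?thesis .
    qed
    have "bij_betw (\<lambda>\<chi>. \<phi> \<otimes>\<^bsub>dual_group S\<^esub> \<chi>) ?D ?D"
      using \<phi> by (intro bij_betw_byWitness[where f' = "\<lambda>\<chi>. inv\<^bsub>dual_group S\<^esub> \<phi> \<otimes>\<^bsub>dual_group S\<^esub> \<chi>"])
        (auto simp: D.m_assoc[symmetric] simp del: dual_group_simps)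
    then have "(\<Prod>\<chi>\<in>?D. fourier S \<chi> A) = (\<Prod>\<chi>\<in>?D. fourier S (\<phi> \<otimes>\<^bsub>dual_group S\<^esub> \<chi>) A)"
      by (rule prod.reindex_bij_betw[symmetric])
    also have "\<dots> = (\<Otimes>\<^bsub>R\<^esub> \<chi>\<in>?D. fourier S (\<phi> \<otimes>\<^bsub>dual_group S\<^esub> \<chi>) A)"
      using trans_closed unfolding R_def by (intro finprod_cpoly_ring[symmetric]) auto
    also have "\<dots> = fourier S \<phi> (finprod ?RS ?F ?D)"
      using F_closed by (subst hom.hom_finprod) (auto simp: comp_def F)
    finally show "fourier S \<phi> ?l = fourier S \<phi> (finprod ?RS ?F ?D)"
      using S(2) by (simp add: R_def fourier_term character_one[OF S.group_axioms \<phi>])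
  qed
qed

section \<open>Grouping the linear factors over a subgroup\<close>

definition extension_product ::
  "('a, 'b) monoid_scheme \<Rightarrow> 'a set \<Rightarrow> ('a \<Rightarrow> complex) \<Rightarrow> 'a cpoly" where
  "extension_product G H \<chi> =
    (\<Prod>\<psi> | \<psi> \<in> carrier (dual_group G) \<and> restrict \<psi> H = \<chi>. fourier G \<psi> pvar)"

text \<open>
  Every character of the group restricts to exactly one character of the subgroup, so the products
  over the fibres of restriction regroup the linear factors of the group determinant.
\<close>

lemma prod_extension_product:
  assumes "Group.comm_group G" "finite (carrier G)" "subgroup H G"
  shows "(\<Prod>\<chi>\<in>carrier (dual_group (G\<lparr>carrier := H\<rparr>)). extension_product G H \<chi>) = group_determinant G"
proof -
  interpret G: Group.comm_group G by fact
  interpret H: subgroup H G by fact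
  let ?D = "carrier (dual_group G)" and ?DH = "carrier (dual_group (G\<lparr>carrier := H\<rparr>))"
  have finH: "finite H" using H.subset assms(2) by (rule finite_subset)
  have fin: "finite ?D" by (rule finite_dual_group[OF G.group_axioms assms(2)])
  have finDH: "finite ?DH"
    using finite_dual_group[OF H.subgroup_is_group[OF G.group_axioms]] finH by simp
  have "(\<lambda>\<psi>. restrict \<psi> H) ` ?D \<subseteq> ?DH"
    using H.subset by (auto simp: dual_group_iff subset_iff)
  then have "(\<Prod>\<chi>\<in>?DH. extension_product G H \<chi>) = (\<Prod>\<psi>\<in>?D. fourier G \<psi> pvar)"
    unfolding extension_product_def by (rule prod.group[OF fin finDH])
  then show ?thesis
    by (simp add: group_determinant_eq_prod[OF assms(1,2)] fourier_def)
qed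

text \<open>
  One linear factor per extension, and a character of the subgroup has index many extensions.
\<close>

lemma extension_product_in_forms:
  assumes "Group.comm_group G" "finite (carrier G)" "subgroup H G"
    and "\<chi> \<in> carrier (dual_group (G\<lparr>carrier := H\<rparr>))"
  shows "extension_product G H \<chi> \<in> forms (carrier G) (card (rcosets\<^bsub>G\<^esub> H))"
proof -
  interpret G: Group.comm_group G by fact
  have "fourier G \<psi> pvar \<in> forms (carrier G) 1" for \<psi>
    unfolding fourier_def by (intro forms_sum forms_pconst_mult pvar_in_forms)
  then show ?thesis
    unfolding extension_product_def card_extensions_of_character[OF assms, symmetric]
    using finite_dual_group[OF G.group_axioms assms(2)] by (intro forms_prod) auto
qed

text \<open>
  The element of the subgroup's group algebra with prescribed Fourier transforms. It equals the
  product of \<open>\<Sum>g. \<psi> g * x\<^sub>g * g\<close> over the characters \<open>\<psi>\<close> that are trivial on the subgroup; defining it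
  by its transforms avoids proving that this product, formed in the group algebra of the whole
  group, is supported on the subgroup.
\<close>

definition subgroup_coefficient ::
  "('a, 'b) monoid_scheme \<Rightarrow> 'a set \<Rightarrow> 'a \<Rightarrow> 'a cpoly" where
  "subgroup_coefficient G H = inverse_fourier (G\<lparr>carrier := H\<rparr>) (extension_product G H)"

lemma subgroup_coefficient_in_forms:
  assumes "Group.comm_group G" "finite (carrier G)" "subgroup H G"
  shows "subgroup_coefficient G H h \<in> forms (carrier G) (card (rcosets\<^bsub>G\<^esub> H))"
  unfolding subgroup_coefficient_def inverse_fourier_def
  by (intro forms_pconst_mult forms_sum extension_product_in_forms assms)

text \<open>
  This is what fixes the degree, since the zero polynomial is homogeneous too. Substitute for the
  variables the coefficients of the group algebra element \<open>e + h\<close>. As this element is supported on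
  the subgroup, every linear factor over a character \<open>\<chi>\<close> takes the value \<open>1 + \<chi> h\<close>, and the
  polynomial takes the value that \<open>(e + h)\<^sup>n\<close> has at \<open>h\<close>, where \<open>n\<close> is the index. By the binomial theorem
  this is the sum of the binomial coefficients \<open>n choose k\<close> over the exponents with \<open>h\<^sup>k = h\<close>,
  a positive integer.
\<close>

lemma subgroup_coefficient_nonzero:
  fixes G :: "('a, 'b) monoid_scheme"
  assumes "Group.comm_group G" "finite (carrier G)" "subgroup H G" and h: "h \<in> H"
  shows "subgroup_coefficient G H h \<noteq> 0"
proof -
  interpret G: Group.comm_group G by fact
  interpret H: subgroup H G by fact
  let ?S = "G\<lparr>carrier := H\<rparr>" and ?n = "card (rcosets\<^bsub>G\<^esub> H)"
  let ?DH = "carrier (dual_group ?S)"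
  have S: "Group.comm_group ?S" by (rule comm_group_subgroup[OF assms(1,3)])
  interpret S: Group.comm_group ?S by fact
  have hS: "h \<in> carrier ?S" and hG: "h \<in> carrier G" using h by auto
  have finH: "finite H" using H.subset assms(2) by (rule finite_subset)
  have cardH: "card H \<noteq> 0" using finH h by auto
  have "?n * card H = card (carrier G)"
    using G.lagrange[OF assms(3)] by (simp add: Coset.order_def)
  moreover have "card (carrier G) \<noteq> 0" using assms(2) hG by auto
  ultimately have n: "1 \<le> ?n" by (cases ?n) auto
  \<comment> \<open>For \<open>h = e\<close> the two indicators add up, so that \<open>v\<close> still represents \<open>e + h = 2 e\<close>.\<close>
  define v :: "'a \<Rightarrow> complex" where "v = (\<lambda>g. of_bool (g = \<one>\<^bsub>G\<^esub>) + of_bool (g = h))"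
  have value_linear: "cpoly_value v (fourier G \<psi> pvar) = 1 + \<psi> h"
    if "\<psi> \<in> carrier (dual_group G)" for \<psi>
  proof -
    have "cpoly_value v (fourier G \<psi> pvar) = (\<Sum>g\<in>carrier G. \<psi> g * of_bool (g = \<one>\<^bsub>G\<^esub>) + \<psi> g * of_bool (g = h))"
      by (simp add: fourier_def cpoly_value_sum cpoly_value_mult v_def distrib_left)
    also have "\<dots> = \<psi> \<one>\<^bsub>G\<^esub> + \<psi> h"
      using assms(2) hG by (simp add: sum.distrib of_bool_def if_distrib[of "\<lambda>z. _ * z"] sum.delta cong: if_cong)
    finally show ?thesis by (simp add: character_one[OF G.group_axioms that])
  qed
  have "cpoly_value v (extension_product G H \<chi>) = (1 + \<chi> h) ^ ?n" if \<chi>: "\<chi> \<in> ?DH" for \<chi>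
  proof -
    have "cpoly_value v (extension_product G H \<chi>) =
        (\<Prod>\<psi> | \<psi> \<in> carrier (dual_group G) \<and> restrict \<psi> H = \<chi>. 1 + \<chi> h)"
      unfolding extension_product_def cpoly_value_prod
      using h by (intro prod.cong refl) (auto simp: value_linear)
    then show ?thesis
      by (simp add: card_extensions_of_character[OF assms(1-3) \<chi>])
  qed
  then have "cpoly_value v (subgroup_coefficient G H h) =
      1 / of_nat (card H) * (\<Sum>\<chi>\<in>?DH. \<chi> (inv\<^bsub>?S\<^esub> h) * (1 + \<chi> h) ^ ?n)"
    by (simp add: subgroup_coefficient_def inverse_fourier_def cpoly_value_mult cpoly_value_sum)
  also have "(\<Sum>\<chi>\<in>?DH. \<chi> (inv\<^bsub>?S\<^esub> h) * (1 + \<chi> h) ^ ?n) =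
      (\<Sum>\<chi>\<in>?DH. \<Sum>k\<le>?n. of_nat (?n choose k) * \<chi> (inv\<^bsub>?S\<^esub> h \<otimes>\<^bsub>?S\<^esub> h [^]\<^bsub>?S\<^esub> k))"
  proof (rule sum.cong[OF refl])
    fix \<chi> assume \<chi>: "\<chi> \<in> ?DH"
    have "\<chi> (inv\<^bsub>?S\<^esub> h \<otimes>\<^bsub>?S\<^esub> h [^]\<^bsub>?S\<^esub> k) = \<chi> (inv\<^bsub>?S\<^esub> h) * \<chi> h ^ k" for k :: nat
      using character_mult[OF \<chi> S.inv_closed[OF hS] S.nat_pow_closed[OF hS]]
        character_pow[OF S.group_axioms \<chi> hS] by simp
    then show "\<chi> (inv\<^bsub>?S\<^esub> h) * (1 + \<chi> h) ^ ?n =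
        (\<Sum>k\<le>?n. of_nat (?n choose k) * \<chi> (inv\<^bsub>?S\<^esub> h \<otimes>\<^bsub>?S\<^esub> h [^]\<^bsub>?S\<^esub> k))"
      by (simp only: binomial_ring[of "\<chi> h" 1] add.commute[of 1] sum_distrib_left)
        (simp add: mult_ac)
  qed
  also have "\<dots> = (\<Sum>k\<le>?n. of_nat (?n choose k) * (\<Sum>\<chi>\<in>?DH. \<chi> (inv\<^bsub>?S\<^esub> h \<otimes>\<^bsub>?S\<^esub> h [^]\<^bsub>?S\<^esub> k)))"
    by (subst sum.swap) (simp add: sum_distrib_left)
  also have "\<dots> = (\<Sum>k\<le>?n. of_nat (?n choose k) *
      (if inv\<^bsub>?S\<^esub> h \<otimes>\<^bsub>?S\<^esub> h [^]\<^bsub>?S\<^esub> k = \<one>\<^bsub>?S\<^esub> then of_nat (card H) else 0))"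
    using S.m_closed[OF S.inv_closed[OF hS] S.nat_pow_closed[OF hS]] finH
    by (intro sum.cong refl arg_cong2[where f = times])
      (subst sum_over_dual_group[OF S], simp_all add: card_dual_group[OF S])
  also have "\<dots> = of_nat (card H) * of_nat (\<Sum>k\<le>?n. if inv\<^bsub>?S\<^esub> h \<otimes>\<^bsub>?S\<^esub> h [^]\<^bsub>?S\<^esub> k = \<one>\<^bsub>?S\<^esub>
      then ?n choose k else 0)"
    unfolding of_nat_sum sum_distrib_left by (intro sum.cong refl) simp
  finally have "cpoly_value v (subgroup_coefficient G H h) =
      of_nat (\<Sum>k\<le>?n. if inv\<^bsub>?S\<^esub> h \<otimes>\<^bsub>?S\<^esub> h [^]\<^bsub>?S\<^esub> k = \<one>\<^bsub>?S\<^esub> then ?n choose k else 0)"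
    (is "_ = of_nat ?N") using cardH by simp
  moreover have "0 < ?N"
  proof -
    \<comment> \<open>The exponent one always contributes, with binomial coefficient the index of the subgroup.\<close>
    have "inv\<^bsub>?S\<^esub> h \<otimes>\<^bsub>?S\<^esub> h [^]\<^bsub>?S\<^esub> (1::nat) = \<one>\<^bsub>?S\<^esub>"
      using S.l_inv[OF hS] S.nat_pow_eone[OF hS] by simp
    then have "?n choose 1 \<le> ?N"
      using n member_le_sum[of 1 "{..?n}"
          "\<lambda>k. if inv\<^bsub>?S\<^esub> h \<otimes>\<^bsub>?S\<^esub> h [^]\<^bsub>?S\<^esub> k = \<one>\<^bsub>?S\<^esub> then ?n choose k else 0"] by simp
    moreover have "0 < ?n choose 1" using n by simp
    ultimately show ?thesis by (rule less_le_trans[rotated])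
  qed
  ultimately have "cpoly_value v (subgroup_coefficient G H h) \<noteq> cpoly_value v 0"
    by (simp only: cpoly_value_0 of_nat_eq_0_iff not_gr_zero[symmetric] not_not)
  then show ?thesis by metis
qed

text \<open>
  Here each fibre of restriction has one element, so the prescribed transforms are those of the
  generic element \<open>\<Sum>g. x\<^sub>g * g\<close>, and Fourier inversion returns its coefficients.
\<close>

lemma subgroup_coefficient_carrier:
  assumes "Group.comm_group G" "finite (carrier G)" "h \<in> carrier G"
  shows "subgroup_coefficient G (carrier G) h = pvar h"
proof -
  have "{\<psi> \<in> carrier (dual_group G). restrict \<psi> (carrier G) = \<chi>} = {\<chi>}"
    if "\<chi> \<in> carrier (dual_group G)" for \<chi>
    using that by (auto simp: dual_group_iff extensional_restrict)
  then have "extension_product G (carrier G) \<chi> = fourier G \<chi> pvar"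
    if "\<chi> \<in> carrier (dual_group G)" for \<chi>
    using that by (simp add: extension_product_def)
  then show ?thesis
    using inverse_fourier_fourier[OF assms, of pvar]
    by (simp add: subgroup_coefficient_def inverse_fourier_def)
qed

theorem theorem3:
  fixes G :: "('a, 'b) monoid_scheme" and H :: "'a set"
  assumes "comm_group G" and "finite (carrier G)" and "subgroup H G"
  shows "\<exists>A \<in> H \<rightarrow> carrier (cpoly_ring (carrier G)).
           (\<forall>h \<in> H. homogeneous (A h) \<and> total_degree (A h) = card (rcosets\<^bsub>G\<^esub> H)) \<and>
           group_algebra_term (cpoly_ring (carrier G)) (G\<lparr>carrier := H\<rparr>) (group_determinant G) \<one>\<^bsub>G\<^esub> =
             (\<Otimes>\<^bsub>group_algebra (cpoly_ring (carrier G)) (G\<lparr>carrier := H\<rparr>)\<^esub> \<chi> \<in> carrier (dual_group (G\<lparr>carrier := H\<rparr>)).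
                \<Oplus>\<^bsub>group_algebra (cpoly_ring (carrier G)) (G\<lparr>carrier := H\<rparr>)\<^esub> h \<in> H.
                  group_algebra_term (cpoly_ring (carrier G)) (G\<lparr>carrier := H\<rparr>) (pconst (\<chi> h) * A h) h) \<and>
           (H = carrier G \<longrightarrow> (\<forall>h \<in> H. A h = pvar h))"
proof (intro bexI[of _ "subgroup_coefficient G H"] conjI ballI impI)
  let ?S = "G\<lparr>carrier := H\<rparr>"
  interpret H: subgroup H G by fact
  have S: "comm_group ?S" "finite (carrier ?S)"
    using comm_group_subgroup[OF assms(1,3)] finite_subset[OF H.subset assms(2)] by simp_all
  note form = subgroup_coefficient_in_forms[OF assms]
  show "homogeneous (subgroup_coefficient G H h)" for h
    by (rule forms_homogeneous[OF form])
  show "total_degree (subgroup_coefficient G H h) = card (rcosets\<^bsub>G\<^esub> H)" if "h \<in> H" for h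
    by (rule forms_total_degree[OF form subgroup_coefficient_nonzero[OF assms that]])
  show A: "subgroup_coefficient G H \<in> H \<rightarrow> carrier (cpoly_ring (carrier G))"
    using forms_carrier[OF form] by auto
  show "subgroup_coefficient G H h = pvar h" if "H = carrier G" "h \<in> H" for h
    using subgroup_coefficient_carrier[OF assms(1,2)] that by simp
  have "(\<Prod>\<chi>\<in>carrier (dual_group ?S). fourier ?S \<chi> (subgroup_coefficient G H)) = group_determinant G"
    using prod_extension_product[OF assms]
    by (simp add: subgroup_coefficient_def fourier_inverse_fourier[OF S])
  with group_algebra_factorization[OF S, of "subgroup_coefficient G H" "carrier G"] A
  show "group_algebra_term (cpoly_ring (carrier G)) ?S (group_determinant G) \<one>\<^bsub>G\<^esub> =
      (\<Otimes>\<^bsub>group_algebra (cpoly_ring (carrier G)) ?S\<^esub> \<chi> \<in> carrier (dual_group ?S).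
         \<Oplus>\<^bsub>group_algebra (cpoly_ring (carrier G)) ?S\<^esub> h \<in> H.
           group_algebra_term (cpoly_ring (carrier G)) ?S (pconst (\<chi> h) * subgroup_coefficient G H h) h)"
    by simp
qed

end
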